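(* Let $f:\mathbb R^d\to\mathbb R$ be convex with at least one minimizer $x^*$, and three times continuously differentiable with $\|\nabla^3f(x)-\nabla^3f(y)\|\le L_3\|x-y\|$ for all $x,y\in\mathbb R^d$, where $L_3>0$. Let $H$ be a $\delta$-Hessian estimator: $H(x)=H(x)^\top$ and $\|H(x)-\nabla^2f(x)\|\le\delta$ for all $x\in\mathbb R^d$. By implementing the third-order oracle $\mathbb O_3^\delta$ via the BDGM subroutine, the AINE algorithm with $p=3$ started at $x_0$ (both described in the context) can find an $\epsilon$-solution, i.e. a point $\hat x$ with $f(\hat x)-\min_{x\in\mathbb R^d}f(x)\le\epsilon$, in the inexact second-order oracle (ISO) complexity of $$\tilde O\left((\delta/\epsilon)^{1/2}+(L_3/\epsilon)^{1/5}\right),$$ and each oracle call requires running the BDGM subroutine with $K$ iterations, where $$K=\mathrm{poly}\log\big(\delta^{-1},\epsilon^{-1},L_3,R(x_0),\|\nabla f(x_0)\|,\|\nabla^2f(x_0)\|,\|\nabla^3f(x_0)\|\big)$$ and $R(x_0)=\sup\{\|y-x^*\|:y\in\mathbb R^d,\ f(y)\le f(x_0)\}$.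
   Context: Norms: Euclidean norm for vectors, operator norm for matrices and tensors. The ISO complexity is the number of calls to the inexact Hessian $H(x)$ needed to find an $\epsilon$-solution. $\tilde O(\cdot)$ hides logarithmic factors; the displayed complexity shows only the dependence on $\delta$, $L_3$, $\epsilon$, not on $D_0=\frac12\|x_0-x^*\|^2$. $\mathrm{poly}\log(\cdot)$ denotes a quantity polylogarithmic in the listed arguments. It is assumed without loss of generality that $\|\nabla f(z_t)\|\ge\epsilon/R(x_0)$ at the oracle query points $z_t$, since otherwise, by convexity, $z_t$ is already an $\epsilon$-solution. BDGM (Bregman distance gradient method) subroutine implementing $\mathbb O_3^\delta(z_t)$. Let $\xi>0$ be a numerical constant. Define $$f_t(y)=f(y)+\frac{(\xi^2-1)\delta}{2\xi}\|y-z_t\|^2+\frac{(1+\xi)\xi L_3}{24}\|y-z_t\|^4,$$ $$\rho_t(y)=\tfrac12\langle(H(z_t)+\xi\delta I_d)(y-z_t),y-z_t\rangle+\frac{(\xi+\xi^2)L_3}{12}\|y-z_t\|^4,$$ $R_t=2\big(12\|\nabla f(z_t)\|/(L_3(\xi^2-1))\big)^{1/3}$, and the Bregman distance $\beta_{\rho_t}(y,y')=\rho_t(y')-\rho_t(y)-\langle\nabla\rho_t(y),y'-y\rangle$. Start with $k=0$, $y_{t,0}=z_t$. For each $k$ let $\lambda_{t,k}=\frac{\xi^2-1}{\xi}\delta+\frac{(1+\xi)\xi L_3}{6}\|y_{t,k}-z_t\|^2$. While the MS condition $\|\nabla f(y_{t,k})+\lambda_{t,k}(y_{t,k}-z_t)\|\le\frac{\lambda_{t,k}}2\|y_{t,k}-z_t\|$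 is not satisfied, set $$y_{t,k+1}=\arg\min_{\|y-z_t\|\le R_t}\{\langle\nabla f_t(y_{t,k}),y-y_{t,k}\rangle+2(1+1/\xi)\beta_{\rho_t}(y_{t,k},y)\},\qquad k\leftarrow k+1.$$ Upon termination return $(y_t,\lambda_t)=(y_{t,k},\lambda_{t,k})$. AINE algorithm for $p=3$. Initialize $v_0=z_0=x_0$, $A_0=0$, $(y_0,\lambda_0)=\mathbb O_3^\delta(z_0)$. For $t=0,\dots,T-1$: - Guess $\lambda'_t$: if $t=0$, $\lambda'_0=\lambda_0$; else if $t=1$ or $A_t>2A_s$ (where $s$ is the currently stored index), set $s:=t$, store $A_s=A_t$, and choose $\lambda'_t=\lambda'_s=\Theta\big(\delta+(D_0L_3/A_s^{3/2})^{2/5}\big)$; otherwise $\lambda'_t=\lambda'_s$ for the stored $s$. - $a'_{t+1}=\big(1+\sqrt{1+4\lambda'_tA_t}\big)/(2\lambda'_t)$, $A'_{t+1}=A_t+a'_{t+1}$, $z_t=(A_tx_t+a'_{t+1}v_t)/A'_{t+1}$. - If $t>0$: $(y_t,\lambda_t)=\mathbb O_3^\delta(z_t)$. - $\beta_t=\min\{1,\lambda'_t/\lambda_t\}$, $a_{t+1}=\beta_ta'_{t+1}$, $A_{t+1}=A_t+a_{t+1}$. - $\hat x_{t+1}=\big((1-\beta_t)A_tx_t+\beta_tA'_{t+1}y_t\big)/A_{t+1}$; $x_{t+1}$ is a point of $\{x_0,\dots,x_t,\hat x_{t+1}\}$ with smallest value of $f$; $v_{t+1}=v_t-a_{t+1}\nabla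 f(y_t)$. Return $x_T$.
   Formalization: The numerical constant ξ of the BDGM subroutine is taken to be greater than 1 rather than merely positive, since for ξ ≤ 1 the radius R_t is undefined or negative and the subroutine's argmin does not exist. *)

theory Defs
  imports "HOL-Analysis.Analysis"
begin

section \<open>Derivatives\<close>

definition grad :: "('a::euclidean_space \<Rightarrow> real) \<Rightarrow> 'a \<Rightarrow> 'a" where
  "grad f x = (THE D. GDERIV f x :> D)"

text \<open>
  Second and third derivatives are bounded linear maps, so that \<open>norm\<close> on them is the
  operator norm of matrices and of tensors: the norm of a bilinear map
  \<open>T :: 'a \<Rightarrow>\<^sub>L 'a \<Rightarrow>\<^sub>L 'a\<close> is the supremum of \<open>\<bar>T u v \<bullet> w\<bar>\<close> over unit vectors \<open>u\<close>, \<open>v\<close>, \<open>w\<close>.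
\<close>

definition hess :: "('a::euclidean_space \<Rightarrow> real) \<Rightarrow> 'a \<Rightarrow> 'a \<Rightarrow>\<^sub>L 'a" where
  "hess f x = Blinfun (frechet_derivative (grad f) (at x))"

definition third :: "('a::euclidean_space \<Rightarrow> real) \<Rightarrow> 'a \<Rightarrow> 'a \<Rightarrow>\<^sub>L 'a \<Rightarrow>\<^sub>L 'a" where
  "third f x = Blinfun (frechet_derivative (hess f) (at x))"

definition three_times_cont_diff :: "('a::euclidean_space \<Rightarrow> real) \<Rightarrow> bool" where
  "three_times_cont_diff f \<longleftrightarrow>
     (\<forall>x. f differentiable at x) \<and> (\<forall>x. grad f differentiable at x) \<and>
     (\<forall>x. hess f differentiable at x) \<and> continuous_on UNIV (third f)"


section \<open>The problem\<close>

definition eps_solution :: "('a \<Rightarrow> real) \<Rightarrow> real \<Rightarrow> 'a \<Rightarrow> bool" where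
  "eps_solution f \<epsilon> x \<longleftrightarrow> f x - (INF y. f y) \<le> \<epsilon>"

definition hessian_estimator ::
  "('a::euclidean_space \<Rightarrow> real) \<Rightarrow> real \<Rightarrow> ('a \<Rightarrow> 'a \<Rightarrow>\<^sub>L 'a) \<Rightarrow> bool" where
  "hessian_estimator f \<delta> H \<longleftrightarrow>
     (\<forall>x. (\<forall>u w. blinfun_apply (H x) u \<bullet> w = u \<bullet> blinfun_apply (H x) w) \<and>
          norm (H x - hess f x) \<le> \<delta>)"

text \<open>A supremum of reals: meaningful only if the sublevel set is bounded.\<close>

definition level_radius :: "('a::euclidean_space \<Rightarrow> real) \<Rightarrow> 'a \<Rightarrow> 'a \<Rightarrow> real" where
  "level_radius f xs x0 = (SUP y\<in>{y. f y \<le> f x0}. norm (y - xs))"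


section \<open>The Bregman distance gradient subroutine\<close>

definition bregman :: "('a::euclidean_space \<Rightarrow> real) \<Rightarrow> 'a \<Rightarrow> 'a \<Rightarrow> real" where
  "bregman \<rho> y y' = \<rho> y' - \<rho> y - grad \<rho> y \<bullet> (y' - y)"

definition bdgm_obj ::
  "('a::euclidean_space \<Rightarrow> real) \<Rightarrow> real \<Rightarrow> real \<Rightarrow> real \<Rightarrow> 'a \<Rightarrow> 'a \<Rightarrow> real" where
  "bdgm_obj f \<delta> L3 \<xi> z y =
     f y + (\<xi>\<^sup>2 - 1) * \<delta> / (2 * \<xi>) * norm (y - z) ^ 2
         + (1 + \<xi>) * \<xi> * L3 / 24 * norm (y - z) ^ 4"

definition bdgm_ref ::
  "('a::euclidean_space \<Rightarrow>\<^sub>L 'a) \<Rightarrow> real \<Rightarrow> real \<Rightarrow> real \<Rightarrow> 'a \<Rightarrow> 'a \<Rightarrow> real" where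
  "bdgm_ref Hz \<delta> L3 \<xi> z y =
     1 / 2 * ((blinfun_apply Hz (y - z) + (\<xi> * \<delta>) *\<^sub>R (y - z)) \<bullet> (y - z))
       + (\<xi> + \<xi>\<^sup>2) * L3 / 12 * norm (y - z) ^ 4"

text \<open>This needs \<open>\<xi> > 1\<close>.\<close>

definition bdgm_radius :: "('a::euclidean_space \<Rightarrow> real) \<Rightarrow> real \<Rightarrow> real \<Rightarrow> 'a \<Rightarrow> real" where
  "bdgm_radius f L3 \<xi> z = 2 * root 3 (12 * norm (grad f z) / (L3 * (\<xi>\<^sup>2 - 1)))"

definition bdgm_lambda :: "real \<Rightarrow> real \<Rightarrow> real \<Rightarrow> 'a::euclidean_space \<Rightarrow> 'a \<Rightarrow> real" where
  "bdgm_lambda \<delta> L3 \<xi> z y = (\<xi>\<^sup>2 - 1) / \<xi> * \<delta> + (1 + \<xi>) * \<xi> * L3 / 6 * norm (y - z) ^ 2"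

definition ms_condition :: "('a::euclidean_space \<Rightarrow> real) \<Rightarrow> real \<Rightarrow> 'a \<Rightarrow> 'a \<Rightarrow> bool" where
  "ms_condition f lam z y \<longleftrightarrow> norm (grad f y + lam *\<^sub>R (y - z)) \<le> lam / 2 * norm (y - z)"

text \<open>
  The subroutine gets the single operator \<open>Hz\<close>, the value of the estimator at \<open>z\<close>,
  and not the estimator itself: one run costs one evaluation of the estimator.
\<close>

primrec bdgm_iter ::
  "('a::euclidean_space \<Rightarrow> real) \<Rightarrow> ('a \<Rightarrow>\<^sub>L 'a) \<Rightarrow> real \<Rightarrow> real \<Rightarrow> real \<Rightarrow> 'a \<Rightarrow> nat \<Rightarrow> 'a" where
  "bdgm_iter f Hz \<delta> L3 \<xi> z 0 = z"
| "bdgm_iter f Hz \<delta> L3 \<xi> z (Suc k) =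
     (let yk = bdgm_iter f Hz \<delta> L3 \<xi> z k in
      arg_min_on (\<lambda>y. grad (bdgm_obj f \<delta> L3 \<xi> z) yk \<bullet> (y - yk)
                      + 2 * (1 + 1 / \<xi>) * bregman (bdgm_ref Hz \<delta> L3 \<xi> z) yk y)
        {y. norm (y - z) \<le> bdgm_radius f L3 \<xi> z})"

definition bdgm_stop ::
  "('a::euclidean_space \<Rightarrow> real) \<Rightarrow> ('a \<Rightarrow>\<^sub>L 'a) \<Rightarrow> real \<Rightarrow> real \<Rightarrow> real \<Rightarrow> 'a \<Rightarrow> nat \<Rightarrow> bool" where
  "bdgm_stop f Hz \<delta> L3 \<xi> z k \<longleftrightarrow>
     (let yk = bdgm_iter f Hz \<delta> L3 \<xi> z k in ms_condition f (bdgm_lambda \<delta> L3 \<xi> z yk) z yk)"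

definition bdgm_terminates ::
  "('a::euclidean_space \<Rightarrow> real) \<Rightarrow> ('a \<Rightarrow>\<^sub>L 'a) \<Rightarrow> real \<Rightarrow> real \<Rightarrow> real \<Rightarrow> 'a \<Rightarrow> bool" where
  "bdgm_terminates f Hz \<delta> L3 \<xi> z \<longleftrightarrow> (\<exists>k. bdgm_stop f Hz \<delta> L3 \<xi> z k)"

definition bdgm_count ::
  "('a::euclidean_space \<Rightarrow> real) \<Rightarrow> ('a \<Rightarrow>\<^sub>L 'a) \<Rightarrow> real \<Rightarrow> real \<Rightarrow> real \<Rightarrow> 'a \<Rightarrow> nat" where
  "bdgm_count f Hz \<delta> L3 \<xi> z = (LEAST k. bdgm_stop f Hz \<delta> L3 \<xi> z k)"

definition bdgm ::
  "('a::euclidean_space \<Rightarrow> real) \<Rightarrow> ('a \<Rightarrow>\<^sub>L 'a) \<Rightarrow> real \<Rightarrow> real \<Rightarrow> real \<Rightarrow> 'a \<Rightarrow> 'a \<times> real" where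
  "bdgm f Hz \<delta> L3 \<xi> z =
     (let y = bdgm_iter f Hz \<delta> L3 \<xi> z (bdgm_count f Hz \<delta> L3 \<xi> z)
      in (y, bdgm_lambda \<delta> L3 \<xi> z y))"


section \<open>The AINE algorithm for third order\<close>

text \<open>
  The state before iteration \<open>t\<close>: \<open>st_x\<close>, \<open>st_v\<close>, \<open>st_A\<close> are \<open>x\<^sub>t\<close>, \<open>v\<^sub>t\<close>, \<open>A\<^sub>t\<close>, and \<open>st_seen\<close> is the
  set of \<open>x\<^sub>0, \<dots>, x\<^sub>t\<close>; \<open>st_As\<close> and \<open>st_guess\<close> are the stored \<open>A\<^sub>s\<close> and \<open>\<lambda>'\<^sub>s\<close> (not yet set, hence
  irrelevant, for \<open>t \<le> 1\<close>); \<open>st_answer\<close> is the last pair returned by the subroutine, and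
  \<open>st_calls\<close> counts the evaluations of the Hessian estimator so far.
\<close>

record 'a aine_state =
  st_x :: 'a
  st_seen :: "'a set"
  st_v :: 'a
  st_A :: real
  st_As :: real
  st_guess :: real
  st_answer :: "'a \<times> real"
  st_calls :: nat

definition aine_init ::
  "('a::euclidean_space \<Rightarrow> real) \<Rightarrow> ('a \<Rightarrow> 'a \<Rightarrow>\<^sub>L 'a) \<Rightarrow> real \<Rightarrow> real \<Rightarrow> real \<Rightarrow> 'a \<Rightarrow> 'a aine_state" where
  "aine_init f H \<delta> L3 \<xi> x0 =
     \<lparr>st_x = x0, st_seen = {x0}, st_v = x0, st_A = 0, st_As = 0, st_guess = 0,
      st_answer = bdgm f (H x0) \<delta> L3 \<xi> x0, st_calls = 1\<rparr>"

definition aine_refresh :: "nat \<Rightarrow> 'a aine_state \<Rightarrow> bool" where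
  "aine_refresh t S \<longleftrightarrow> t = 1 \<or> (t > 1 \<and> st_A S > 2 * st_As S)"

text \<open>
  The guess is only prescribed up to constant factors, as \<open>\<Theta>(\<dots>)\<close>. The sequence \<open>\<kappa>\<close> holds the
  factors actually used; the only condition on it will be that its values lie between two
  positive constants.
\<close>

definition aine_guess ::
  "real \<Rightarrow> real \<Rightarrow> real \<Rightarrow> (nat \<Rightarrow> real) \<Rightarrow> nat \<Rightarrow> 'a aine_state \<Rightarrow> real" where
  "aine_guess \<delta> L3 D0 \<kappa> t S =
     (if t = 0 then snd (st_answer S)
      else if aine_refresh t S
        then \<kappa> t * (\<delta> + (D0 * L3 / st_A S powr (3 / 2)) powr (2 / 5))
      else st_guess S)"

definition aine_a' ::
  "real \<Rightarrow> real \<Rightarrow> real \<Rightarrow> (nat \<Rightarrow> real) \<Rightarrow> nat \<Rightarrow> 'a aine_state \<Rightarrow> real" where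
  "aine_a' \<delta> L3 D0 \<kappa> t S =
     (let lam' = aine_guess \<delta> L3 D0 \<kappa> t S in (1 + sqrt (1 + 4 * lam' * st_A S)) / (2 * lam'))"

definition aine_query ::
  "real \<Rightarrow> real \<Rightarrow> real \<Rightarrow> (nat \<Rightarrow> real) \<Rightarrow> nat \<Rightarrow> 'a::euclidean_space aine_state \<Rightarrow> 'a" where
  "aine_query \<delta> L3 D0 \<kappa> t S =
     (let a' = aine_a' \<delta> L3 D0 \<kappa> t S
      in (1 / (st_A S + a')) *\<^sub>R (st_A S *\<^sub>R st_x S + a' *\<^sub>R st_v S))"

definition aine_step ::
  "('a::euclidean_space \<Rightarrow> real) \<Rightarrow> ('a \<Rightarrow> 'a \<Rightarrow>\<^sub>L 'a) \<Rightarrow> real \<Rightarrow> real \<Rightarrow> real \<Rightarrow> real \<Rightarrow> (nat \<Rightarrow> real)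
     \<Rightarrow> nat \<Rightarrow> 'a aine_state \<Rightarrow> 'a aine_state" where
  "aine_step f H \<delta> L3 \<xi> D0 \<kappa> t S =
     (let A = st_A S;
          lam' = aine_guess \<delta> L3 D0 \<kappa> t S;
          a' = aine_a' \<delta> L3 D0 \<kappa> t S;
          A' = A + a';
          z = aine_query \<delta> L3 D0 \<kappa> t S;
          (y, lam) = (if t > 0 then bdgm f (H z) \<delta> L3 \<xi> z else st_answer S);
          \<beta> = min 1 (lam' / lam);
          a = \<beta> * a';
          xhat = (1 / (A + a)) *\<^sub>R (((1 - \<beta>) * A) *\<^sub>R st_x S + (\<beta> * A') *\<^sub>R y);
          xnew = arg_min_on f (insert xhat (st_seen S))
      in \<lparr>st_x = xnew,
          st_seen = insert xnew (st_seen S),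
          st_v = st_v S - a *\<^sub>R grad f y,
          st_A = A + a,
          st_As = (if aine_refresh t S then A else st_As S),
          st_guess = lam',
          st_answer = (y, lam),
          st_calls = st_calls S + (if t > 0 then 1 else 0)\<rparr>)"

primrec aine ::
  "('a::euclidean_space \<Rightarrow> real) \<Rightarrow> ('a \<Rightarrow> 'a \<Rightarrow>\<^sub>L 'a) \<Rightarrow> real \<Rightarrow> real \<Rightarrow> real \<Rightarrow> real \<Rightarrow> (nat \<Rightarrow> real)
     \<Rightarrow> 'a \<Rightarrow> nat \<Rightarrow> 'a aine_state" where
  "aine f H \<delta> L3 \<xi> D0 \<kappa> x0 0 = aine_init f H \<delta> L3 \<xi> x0"
| "aine f H \<delta> L3 \<xi> D0 \<kappa> x0 (Suc t) =
     aine_step f H \<delta> L3 \<xi> D0 \<kappa> t (aine f H \<delta> L3 \<xi> D0 \<kappa> x0 t)"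


section \<open>Complexity bounds\<close>

text \<open>
  Since the space is a type, an existentially quantified constant in the theorem could depend on
  the dimension. The constants hidden in the asymptotic notation are therefore given explicitly (and
  generously), in terms of the numerical constants of the algorithm alone: \<open>\<xi>\<close>, and the constants
  \<open>c1\<close>, \<open>c2\<close> of the \<open>\<Theta>\<close> in the guess.
\<close>

definition iso_const :: "real \<Rightarrow> real \<Rightarrow> real \<Rightarrow> real" where
  "iso_const \<xi> c1 c2 = 1000 * \<xi> ^ 4 * (1 + 1 / c1)\<^sup>2 * (1 + c2)"

definition bdgm_const :: "real \<Rightarrow> real" where
  "bdgm_const \<xi> = 10000 * \<xi> ^ 5 / (\<xi> - 1) ^ 3"

text \<open>
  \<open>(\<delta>/\<epsilon>)\<^sup>1\<^sup>/\<^sup>2 + (L\<^sub>3/\<epsilon>)\<^sup>1\<^sup>/\<^sup>5\<close> up to a logarithmic factor, with the dependence on \<open>D\<^sub>0\<close> made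
  explicit. The summand 1 accounts for the evaluation that is made even if the rest is small.
\<close>

definition iso_bound :: "real \<Rightarrow> real \<Rightarrow> real \<Rightarrow> real \<Rightarrow> real" where
  "iso_bound \<delta> L3 D0 \<epsilon> =
     (1 + (\<delta> * D0 / \<epsilon>) powr (1 / 2) + (L3 * D0\<^sup>2 / \<epsilon>) powr (1 / 5))
     * (1 + ln (1 + \<delta> * D0 / \<epsilon> + L3 * D0\<^sup>2 / \<epsilon>))"

text \<open>The shift by 2 keeps the logarithms positive for small arguments.\<close>

definition log_sum :: "real list \<Rightarrow> real" where
  "log_sum as = (\<Sum>a\<leftarrow>as. ln (2 + a))"

end

theory Submission
  imports Defs
begin

text \<open>
  The subroutine is a Bregman gradient method: the objective \<open>F\<close> is smooth and strongly convex relative to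
  the reference function \<open>\<rho>\<close>, with constants depending on \<open>\<xi>\<close> only, so that the Bregman distance of the
  iterates to the minimizer \<open>w\<close> of \<open>F\<close> contracts geometrically. All the estimates are relative to
  \<open>r = norm (w - z)\<close>: since \<open>grad F y = grad f y + \<lambda> (y - z)\<close>, the stopping condition holds as soon as the
  distance to \<open>w\<close> is a fixed fraction of \<open>r\<close>, the fraction depending on \<open>\<xi>\<close> and \<open>norm (hess f z) / \<delta>\<close>
  only.

  For the outer loop, the stopping condition makes the potential
  \<open>A (f x - f xs) + (norm (v - xs))\<^sup>2 / 2\<close> decrease by a multiple of \<open>\<beta> A' \<lambda> (norm (y - z))\<^sup>2\<close>. While
  \<open>A < D0 / \<epsilon>\<close>, a step either has \<open>\<lambda> \<le> G \<lambda>'\<close> and then increases \<open>ln A\<close> by \<open>1 / (1 + G W)\<close>, or it decreases the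
  potential by a fixed amount \<open>\<Delta>\<close>. As \<open>1 / A\<close> is bounded after the first step and the potential is at
  most \<open>D0\<close>, this bounds the number of steps of both kinds.
\<close>

section \<open>Derivatives and convexity\<close>

text \<open>A linear functional into the reals is represented by the vector
  \<open>adjoint f' 1\<close>. Its uniqueness gives the definite description in \<open>grad\<close>
  a value.\<close>

lemma has_derivative_grad:
  assumes "f differentiable at x"
  shows "(f has_derivative (\<lambda>h. grad f x \<bullet> h)) (at x)"
proof -
  obtain f' where f': "(f has_derivative f') (at x)"
    using assms by (auto simp: differentiable_def)
  then have "linear f'"
    by (simp add: bounded_linear.linear has_derivative_bounded_linear)
  have f'_eq: "f' = (\<lambda>h. h \<bullet> adjoint f' 1)"
    using adjoint_works[OF \<open>linear f'\<close>, of _ 1] by (simp add: fun_eq_iff)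
  then have *: "GDERIV f x :> adjoint f' 1"
    using f' unfolding gderiv_def by (rule has_derivative_eq_rhs[rotated])
  have "D = adjoint f' 1" if "GDERIV f x :> D" for D
  proof -
    have "(\<lambda>h. h \<bullet> D) = (\<lambda>h. h \<bullet> adjoint f' 1)"
      using has_derivative_unique[OF that[unfolded gderiv_def] *[unfolded gderiv_def]] .
    then show ?thesis
      using vector_eq_ldot[of D "adjoint f' 1"] by (simp add: fun_eq_iff)
  qed
  then have "grad f x = adjoint f' 1"
    unfolding grad_def using * by (intro the_equality)
  with * show ?thesis
    by (simp add: gderiv_def inner_commute)
qed

lemma grad_eqI:
  assumes "(f has_derivative (\<lambda>h. D \<bullet> h)) (at x)"
  shows "grad f x = D"
proof -
  have "(f has_derivative (\<lambda>h. grad f x \<bullet> h)) (at x)"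
    using assms by (intro has_derivative_grad) (auto simp: differentiable_def)
  then have "(\<lambda>h. grad f x \<bullet> h) = (\<lambda>h. D \<bullet> h)"
    using assms has_derivative_unique by blast
  then show ?thesis
    using vector_eq_rdot[of "grad f x" D] by (simp add: fun_eq_iff)
qed

lemma has_derivative_Blinfun_frechet:
  assumes "f differentiable at x"
  shows "(f has_derivative blinfun_apply (Blinfun (frechet_derivative f (at x)))) (at x)"
  using assms bounded_linear_Blinfun_apply frechet_derivative_works has_derivative_bounded_linear
  by metis

text \<open>Integrates a sign condition on the second derivative twice. It will be applied along a
  segment to the difference between a function and an explicit polynomial.\<close>

lemma second_order_tangent:
  fixes g g' g'' :: "real \<Rightarrow> real"
  assumes g: "\<And>s. (g has_real_derivative g' s) (at s)"
    and g': "\<And>s. (g' has_real_derivative g'' s) (at s)"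
    and nonneg: "\<And>s. 0 \<le> s \<Longrightarrow> s \<le> 1 \<Longrightarrow> 0 \<le> g'' s"
  shows "g 0 + g' 0 \<le> g 1"
proof -
  have mono: "g' 0 \<le> g' s" if "0 \<le> s" "s \<le> 1" for s
    using DERIV_nonneg_imp_nondecreasing[of 0 s g'] g' nonneg that by force
  have "(\<lambda>s. g s - s * g' 0) 0 \<le> (\<lambda>s. g s - s * g' 0) 1"
  proof (rule DERIV_nonneg_imp_nondecreasing[of 0 1 "\<lambda>s. g s - s * g' 0"])
    fix s :: real assume "0 \<le> s" "s \<le> 1"
    then have "0 \<le> g' s - g' 0"
      using mono by simp
    moreover have "((\<lambda>s. g s - s * g' 0) has_real_derivative g' s - g' 0) (at s)"
      by (auto intro!: derivative_eq_intros g)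
    ultimately show "\<exists>y. ((\<lambda>s. g s - s * g' 0) has_real_derivative y) (at s) \<and> 0 \<le> y"
      by blast
  qed simp
  then show ?thesis
    by simp
qed

section \<open>Hessian estimates for convex functions with Lipschitz third derivative\<close>

locale smooth_convex =
  fixes f :: "'a::euclidean_space \<Rightarrow> real" and L3 :: real
  assumes convex: "convex_on UNIV f"
    and smooth: "three_times_cont_diff f"
    and L3_pos: "0 < L3"
    and third_lipschitz: "\<And>x y. norm (third f x - third f y) \<le> L3 * norm (x - y)"
begin

lemma has_derivative_f: "(f has_derivative (\<lambda>h. grad f x \<bullet> h)) (at x)"
  using smooth by (simp add: has_derivative_grad three_times_cont_diff_def)

lemma has_derivative_grad_f: "(grad f has_derivative blinfun_apply (hess f x)) (at x)"
  using smooth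
  by (simp add: hess_def three_times_cont_diff_def has_derivative_Blinfun_frechet)

lemma has_derivative_hess_f: "(hess f has_derivative blinfun_apply (third f x)) (at x)"
  using smooth
  by (simp add: third_def three_times_cont_diff_def has_derivative_Blinfun_frechet)

lemma DERIV_f_line:
  "((\<lambda>s. f (y + s *\<^sub>R d)) has_real_derivative grad f (y + s *\<^sub>R d) \<bullet> d) (at s)"
  unfolding has_field_derivative_def
  by (rule has_derivative_eq_rhs, rule has_derivative_compose[OF _ has_derivative_f])
     (auto intro!: derivative_eq_intros ext simp: algebra_simps)

lemma DERIV_grad_line:
  "((\<lambda>s. grad f (y + s *\<^sub>R d) \<bullet> u) has_real_derivative hess f (y + s *\<^sub>R d) d \<bullet> u) (at s)"
  unfolding has_field_derivative_def
  by (rule has_derivative_eq_rhs, rule has_derivative_inner_left,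
      rule has_derivative_compose[OF _ has_derivative_grad_f])
     (auto intro!: derivative_eq_intros ext simp: blinfun.scaleR_right)

lemma DERIV_hess_line:
  "((\<lambda>s. hess f (y + s *\<^sub>R d) u \<bullet> u) has_real_derivative third f (y + s *\<^sub>R d) d u \<bullet> u) (at s)"
proof -
  have "((\<lambda>s. hess f (y + s *\<^sub>R d)) has_derivative (\<lambda>t. third f (y + s *\<^sub>R d) (t *\<^sub>R d))) (at s)"
    by (rule has_derivative_compose[OF _ has_derivative_hess_f])
       (auto intro!: derivative_eq_intros)
  from has_derivative_inner_left[OF bounded_linear.has_derivative[OF blinfun.bounded_linear_left this]]
  show ?thesis
    unfolding has_field_derivative_def
    by (rule has_derivative_eq_rhs) (auto simp: blinfun.scaleR_right blinfun.scaleR_left)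
qed

lemma grad_inequality: "f x + grad f x \<bullet> (y - x) \<le> f y"
proof -
  have "convex_on UNIV (\<lambda>s. f (x + s *\<^sub>R (y - x)))"
  proof (rule convex_onI)
    fix t a b :: real
    assume "0 < t" "t < 1"
    have "x + ((1 - t) *\<^sub>R a + t *\<^sub>R b) *\<^sub>R (y - x)
        = (1 - t) *\<^sub>R (x + a *\<^sub>R (y - x)) + t *\<^sub>R (x + b *\<^sub>R (y - x))"
      by (simp add: algebra_simps)
    then show "f (x + ((1 - t) *\<^sub>R a + t *\<^sub>R b) *\<^sub>R (y - x))
        \<le> (1 - t) * f (x + a *\<^sub>R (y - x)) + t * f (x + b *\<^sub>R (y - x))"
      using convex_onD[OF convex, of t] \<open>0 < t\<close> \<open>t < 1\<close> by simp
  qed auto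
  from convex_on_imp_above_tangent[OF this, of 0 1 "grad f x \<bullet> (y - x)"]
    DERIV_f_line[of x "y - x" 0]
  show ?thesis
    by simp
qed

lemma hess_nonneg: "0 \<le> hess f x u \<bullet> u"
proof (rule ccontr)
  let ?g = "\<lambda>s. grad f (x + s *\<^sub>R u) \<bullet> u"
  assume "\<not> ?thesis"
  with DERIV_neg_dec_right[of ?g "hess f x u \<bullet> u" 0] DERIV_grad_line[of x u u 0]
  obtain e where e: "e > 0" "\<And>h. 0 < h \<Longrightarrow> h < e \<Longrightarrow> ?g h < ?g 0"
    by auto
  have "?g (e / 2) < ?g 0"
    using e by simp
  \<comment> \<open>The tangent inequalities at the two points add up to monotonicity of the
    gradient along \<open>u\<close>.\<close>
  moreover have "0 \<le> (e / 2) * (?g (e / 2) - ?g 0)"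
    using grad_inequality[of x "x + (e / 2) *\<^sub>R u"] grad_inequality[of "x + (e / 2) *\<^sub>R u" x]
    by (simp add: algebra_simps)
  ultimately show False
    using e(1) by (simp add: zero_le_mult_iff)
qed

text \<open>The sign \<open>\<sigma>\<close> treats both directions at once. Along the segment,
  remainder bound minus signed error has a nonnegative derivative by the Lipschitz property of
  \<open>third f\<close>.\<close>

lemma hess_taylor:
  fixes \<sigma> :: real
  assumes "\<bar>\<sigma>\<bar> = 1"
  shows "\<sigma> * (hess f (x + h) u \<bullet> u - hess f x u \<bullet> u - third f x h u \<bullet> u)
    \<le> L3 / 2 * (norm h)\<^sup>2 * (norm u)\<^sup>2"
proof -
  let ?g = "\<lambda>s. L3 / 2 * s\<^sup>2 * (norm h)\<^sup>2 * (norm u)\<^sup>2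
    - \<sigma> * (hess f (x + s *\<^sub>R h) u \<bullet> u - s * (third f x h u \<bullet> u))"
  let ?g' = "\<lambda>s. L3 * s * (norm h)\<^sup>2 * (norm u)\<^sup>2
    - \<sigma> * (third f (x + s *\<^sub>R h) h u \<bullet> u - third f x h u \<bullet> u)"
  have "?g 0 \<le> ?g 1"
  proof (rule DERIV_nonneg_imp_nondecreasing[of 0 1 ?g])
    fix s :: real assume s: "0 \<le> s" "s \<le> 1"
    have "(?g has_real_derivative ?g' s) (at s)"
      by (auto intro!: derivative_eq_intros DERIV_hess_line)
    moreover have "\<bar>\<sigma> * (third f (x + s *\<^sub>R h) h u \<bullet> u - third f x h u \<bullet> u)\<bar>
      \<le> L3 * s * (norm h)\<^sup>2 * (norm u)\<^sup>2"
    proof -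
      let ?D = "third f (x + s *\<^sub>R h) - third f x"
      have "\<bar>\<sigma> * (third f (x + s *\<^sub>R h) h u \<bullet> u - third f x h u \<bullet> u)\<bar> = \<bar>?D h u \<bullet> u\<bar>"
        using assms by (simp add: abs_mult blinfun.diff_left inner_diff_left)
      also have "\<dots> \<le> norm (?D h u) * norm u"
        by (rule Cauchy_Schwarz_ineq2)
      also have "norm (?D h u) \<le> norm ?D * norm h * norm u"
        by (meson norm_blinfun norm_ge_zero mult_right_mono order_trans)
      also have "norm ?D \<le> L3 * (s * norm h)"
        using third_lipschitz[of "x + s *\<^sub>R h" x] s by simp
      finally show ?thesis
        by (simp add: power2_eq_square mult_right_mono mult_ac)
    qed
    ultimately show "\<exists>y. (?g has_real_derivative y) (at s) \<and> 0 \<le> y"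
      by (intro exI[of _ "?g' s"]) linarith
  qed simp
  then show ?thesis
    by (simp add: algebra_simps)
qed

text \<open>Nonnegativity of the Hessian at \<open>x \<plusminus> \<xi> h\<close> controls the third derivative.\<close>

lemma third_bound:
  assumes "0 < \<xi>"
  shows "\<bar>third f x h u \<bullet> u\<bar> \<le> 1 / \<xi> * (hess f x u \<bullet> u) + \<xi> * L3 / 2 * (norm h)\<^sup>2 * (norm u)\<^sup>2"
proof -
  have "- (\<sigma> * (third f x h u \<bullet> u))
      \<le> 1 / \<xi> * (hess f x u \<bullet> u) + \<xi> * L3 / 2 * (norm h)\<^sup>2 * (norm u)\<^sup>2"
    if "\<bar>\<sigma>\<bar> = 1" for \<sigma>
  proof -
    have s2: "\<sigma>\<^sup>2 = 1"
      using that by (metis power2_abs power_one)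
    have "0 \<le> hess f (x + (\<xi> * \<sigma>) *\<^sub>R h) u \<bullet> u"
      by (rule hess_nonneg)
    also have "\<dots> \<le> hess f x u \<bullet> u + \<xi> * \<sigma> * (third f x h u \<bullet> u)
        + L3 / 2 * \<xi>\<^sup>2 * (norm h)\<^sup>2 * (norm u)\<^sup>2"
      using hess_taylor[of 1 x "(\<xi> * \<sigma>) *\<^sub>R h" u] s2
      by (simp add: blinfun.scaleR_right blinfun.scaleR_left power_mult_distrib)
    finally show ?thesis
      using assms by (simp add: field_simps power2_eq_square)
  qed
  from this[of 1] this[of "-1"] show ?thesis
    by (simp add: abs_if)
qed

text \<open>Taylor expansion with the third-order term absorbed: \<open>third_bound\<close> trades
  it for a fraction \<open>1 / \<xi>\<close> of the Hessian at \<open>x\<close> and a larger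
  quadratic remainder.\<close>

lemma hess_upper:
  assumes "0 < \<xi>"
  shows "hess f (x + h) u \<bullet> u
    \<le> (1 + 1 / \<xi>) * (hess f x u \<bullet> u) + (1 + \<xi>) * L3 / 2 * (norm h)\<^sup>2 * (norm u)\<^sup>2"
  using hess_taylor[of 1 x h u] third_bound[OF assms, of x h u]
  by (simp add: algebra_simps add_divide_distrib)

lemma hess_lower:
  assumes "0 < \<xi>"
  shows "(1 - 1 / \<xi>) * (hess f x u \<bullet> u) - (1 + \<xi>) * L3 / 2 * (norm h)\<^sup>2 * (norm u)\<^sup>2
    \<le> hess f (x + h) u \<bullet> u"
  using hess_taylor[of "-1" x h u] third_bound[OF assms, of x h u]
  by (simp add: algebra_simps add_divide_distrib)

text \<open>Mean value inequality on the segment. It transfers the size of the Hessian from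
  \<open>x0\<close> to a query point.\<close>

lemma norm_hess_bound:
  "norm (hess f y) \<le> norm (hess f x) + (norm (third f x) + L3 * norm (y - x)) * norm (y - x)"
proof -
  have "norm (hess f y - hess f x) \<le> (norm (third f x) + L3 * norm (y - x)) * norm (y - x)"
  proof (rule differentiable_bound[where S = "closed_segment x y" and f' = "\<lambda>w. blinfun_apply (third f w)"])
    fix w assume w: "w \<in> closed_segment x y"
    show "(hess f has_derivative blinfun_apply (third f w)) (at w within closed_segment x y)"
      by (rule has_derivative_at_withinI[OF has_derivative_hess_f])
    have "norm (w - x) \<le> norm (y - x)"
      using w segment_bound(1) by blast
    then have "norm (third f w - third f x) \<le> L3 * norm (y - x)"
      using third_lipschitz[of w x] L3_pos by (meson mult_left_mono order_trans less_imp_le)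
    then show "onorm (blinfun_apply (third f w)) \<le> norm (third f x) + L3 * norm (y - x)"
      using norm_triangle_sub[of "third f w" "third f x"] by (simp add: norm_blinfun.rep_eq[symmetric])
  qed auto
  then show ?thesis
    using norm_triangle_sub[of "hess f y" "hess f x"] by linarith
qed

end

section \<open>Attained minima and first-order optimality\<close>

lemma is_arg_min_arg_min_on:
  assumes "\<exists>x\<in>S. \<forall>y\<in>S. f x \<le> (f y :: real)"
  shows "arg_min_on f S \<in> S" "\<And>y. y \<in> S \<Longrightarrow> f (arg_min_on f S) \<le> f y"
proof -
  have "\<exists>x. is_arg_min f (\<lambda>x. x \<in> S) x"
    using assms by (force simp: is_arg_min_def)
  then have "is_arg_min f (\<lambda>x. x \<in> S) (arg_min_on f S)"
    unfolding arg_min_on_def arg_min_def by (rule someI_ex)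
  then show "arg_min_on f S \<in> S" "\<And>y. y \<in> S \<Longrightarrow> f (arg_min_on f S) \<le> f y"
    by (auto simp: is_arg_min_def not_less)
qed

text \<open>A negative slope towards \<open>y\<close> would let a short move along the segment,
  which stays in \<open>C\<close>, decrease \<open>g\<close>.\<close>

lemma minimum_on_convex_derivative:
  fixes g :: "'a::real_normed_vector \<Rightarrow> real"
  assumes C: "convex C" "x \<in> C" "y \<in> C"
    and deriv: "(g has_derivative g') (at x)"
    and min: "\<And>w. w \<in> C \<Longrightarrow> g x \<le> g w"
  shows "0 \<le> g' (y - x)"
proof (rule ccontr)
  assume neg: "\<not> ?thesis"
  let ?m = "\<lambda>s. g (x + s *\<^sub>R (y - x))"
  have "(g has_derivative g') (at (x + 0 *\<^sub>R (y - x)))"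
    using deriv by simp
  then have "(?m has_derivative (\<lambda>s. g' (s *\<^sub>R (y - x)))) (at 0)"
    by (rule has_derivative_compose[rotated]) (auto intro!: derivative_eq_intros)
  moreover have "(\<lambda>s. g' (s *\<^sub>R (y - x))) = (*) (g' (y - x))"
    using has_derivative_bounded_linear[OF deriv]
    by (simp add: fun_eq_iff bounded_linear.linear linear_scale)
  ultimately have "(?m has_real_derivative g' (y - x)) (at 0)"
    by (simp add: has_field_derivative_def)
  from DERIV_neg_dec_right[OF this] neg
  obtain e where e: "e > 0" "\<And>s. 0 < s \<Longrightarrow> s < e \<Longrightarrow> ?m s < ?m 0"
    by auto
  \<comment> \<open>Capped at 1 to stay on the segment, halved to stay strictly below
    \<open>e\<close>.\<close>
  let ?s = "min (e / 2) 1"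
  have "x + ?s *\<^sub>R (y - x) = (1 - ?s) *\<^sub>R x + ?s *\<^sub>R y"
    by (simp add: algebra_simps)
  also have "\<dots> \<in> C"
    using C e(1) by (intro convexD_alt) auto
  finally have "g x \<le> ?m ?s"
    by (rule min)
  moreover have "0 < ?s" "?s < e"
    using e(1) by (auto simp: min_def)
  ultimately show False
    using e(2)[of ?s] by simp
qed

section \<open>Bregman distances\<close>

text \<open>Turns the inner product in the optimality condition of a subroutine step into a
  difference of Bregman distances.\<close>

lemma bregman_three_point:
  "bregman \<rho> a c - bregman \<rho> a b - bregman \<rho> b c = (grad \<rho> b - grad \<rho> a) \<bullet> (c - b)"
  by (simp add: bregman_def algebra_simps)

section \<open>The Bregman distance of the fourth power of the norm\<close>

lemma norm_power4: "norm (x::'a::real_inner) ^ 4 = (x \<bullet> x)\<^sup>2"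
  using power_mult[of "norm x" 2 2] by (simp add: power2_norm_eq_inner)

text \<open>The Bregman distance of \<open>norm x ^ 4\<close> from \<open>h\<close> to \<open>h + d\<close>.\<close>

definition breg4 :: "'a::real_inner \<Rightarrow> 'a \<Rightarrow> real" where
  "breg4 h d = (2 * (h \<bullet> d) + (norm d)\<^sup>2)\<^sup>2 + 2 * (norm h)\<^sup>2 * (norm d)\<^sup>2"

lemma breg4_nonneg: "0 \<le> breg4 h d"
  by (simp add: breg4_def)

lemma breg4_eq:
  "norm (h + d) ^ 4 - norm h ^ 4 - 4 * (norm h)\<^sup>2 * (h \<bullet> d) = breg4 h d"
  unfolding norm_power4 breg4_def power2_norm_eq_inner
  by (simp add: algebra_simps inner_commute power2_eq_square)

text \<open>The bracket is the integral of
  \<open>(1 - s) * (norm (h + s *\<^sub>R d))\<^sup>2\<close> over \<open>s\<close> in [0, 1], the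
  form in which the Hessian remainder appears after integration. The difference of the two sides is
  a sum of squares, up to the factor 4.\<close>

lemma breg4_taylor:
  "(norm d)\<^sup>2 * ((norm h)\<^sup>2 / 2 + h \<bullet> d / 3 + (norm d)\<^sup>2 / 12) \<le> breg4 h d / 4"
proof -
  have "0 \<le> (2 * (h \<bullet> d) + 2 / 3 * (norm d)\<^sup>2)\<^sup>2 + 2 / 9 * ((norm d)\<^sup>2)\<^sup>2"
    by simp
  also have "\<dots> = breg4 h d
      - 4 * ((norm d)\<^sup>2 * ((norm h)\<^sup>2 / 2 + h \<bullet> d / 3 + (norm d)\<^sup>2 / 12))"
    unfolding breg4_def by (simp add: field_simps power2_eq_square)
  finally show ?thesis
    by linarith
qed

text \<open>The weight is the norm at the end point \<open>h + d\<close>, because the end point will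
  be the fixed minimizer while \<open>h\<close> belongs to a moving iterate.\<close>

lemma breg4_lower: "(norm (h + d))\<^sup>2 * (norm d)\<^sup>2 / 4 \<le> breg4 h d"
proof -
  define N D r where "N = (norm h)\<^sup>2" and "D = (norm d)\<^sup>2" and "r = (norm (h + d))\<^sup>2"
  have nn: "0 \<le> N" "0 \<le> D" "0 \<le> r"
    by (simp_all add: N_def D_def r_def)
  have "r = N + 2 * (h \<bullet> d) + D"
    unfolding N_def D_def r_def power2_norm_eq_inner by (simp add: algebra_simps inner_commute)
  then have b: "breg4 h d = (r - N)\<^sup>2 + 2 * N * D"
    unfolding breg4_def N_def[symmetric] D_def[symmetric] by simp
  \<comment> \<open>Parallelogram identity for \<open>h + d\<close> and \<open>h\<close>, with the
    square of their sum dropped.\<close>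
  have par: "D \<le> 2 * r + 2 * N"
  proof -
    have "D = 2 * r + 2 * N - (norm ((h + d) + h))\<^sup>2"
      unfolding N_def D_def r_def power2_norm_eq_inner by (simp add: algebra_simps inner_commute)
    then show ?thesis
      by simp
  qed
  have "r * D / 4 \<le> breg4 h d"
  \<comment> \<open>If \<open>N\<close> is at least an eighth of \<open>r\<close>, the term
    \<open>2 * N * D\<close> suffices. Otherwise \<open>(r - N)\<^sup>2\<close> is at least 49/64 of
    \<open>r\<^sup>2\<close>, which exceeds the 9/16 needed.\<close>
  proof (cases "r \<le> 8 * N")
    case True
    then have "r * D \<le> 8 * N * D"
      using nn by (intro mult_right_mono)
    then show ?thesis
      unfolding b using zero_le_power2[of "r - N"] by linarith
  next
    case False
    then have "D \<le> 9 / 4 * r"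
      using par by linarith
    then have "r * D \<le> r * (9 / 4 * r)"
      using nn by (intro mult_left_mono)
    moreover have "(7 / 8 * r)\<^sup>2 \<le> (r - N)\<^sup>2"
      using False nn by (intro power_mono) auto
    moreover have "0 \<le> 2 * N * D" "0 \<le> r * r"
      using nn by auto
    ultimately show ?thesis
      unfolding b by (simp only: power_mult_distrib power2_eq_square)
  qed
  then show ?thesis
    by (simp add: r_def D_def)
qed

text \<open>The constant is \<open>5\<^sup>2 + 2 * 2\<^sup>2\<close>: the first square is bounded
  through \<open>2 * norm h + norm d\<close>, which is at most \<open>5 * r\<close>.\<close>

lemma breg4_upper:
  assumes "norm h \<le> 2 * r" "norm d \<le> r"
  shows "breg4 h d \<le> 33 * r\<^sup>2 * (norm d)\<^sup>2"
proof -
  have r: "0 \<le> r"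
    using assms(2) norm_ge_zero[of d] by linarith
  have "\<bar>2 * (h \<bullet> d) + (norm d)\<^sup>2\<bar> \<le> 2 * (norm h * norm d) + norm d * norm d"
    using Cauchy_Schwarz_ineq2[of h d] zero_le_square[of "norm d"]
    unfolding power2_eq_square by linarith
  also have "\<dots> = (2 * norm h + norm d) * norm d"
    by (simp add: algebra_simps)
  also have "\<dots> \<le> 5 * r * norm d"
    using assms by (intro mult_right_mono) auto
  finally have "(2 * (h \<bullet> d) + (norm d)\<^sup>2)\<^sup>2 \<le> (5 * r * norm d)\<^sup>2"
    using abs_le_square_iff by fastforce
  moreover have "(norm h)\<^sup>2 * (norm d)\<^sup>2 \<le> (2 * r)\<^sup>2 * (norm d)\<^sup>2"
    using assms by (intro mult_right_mono power_mono) auto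
  ultimately show ?thesis
    unfolding breg4_def by (simp add: power_mult_distrib)
qed

lemma has_derivative_norm4:
  "((\<lambda>y. norm (y - z) ^ 4) has_derivative (\<lambda>d. (4 * (norm (y - z))\<^sup>2) * ((y - z) \<bullet> d))) (at y)"
  unfolding norm_power4 power2_norm_eq_inner
  by (rule has_derivative_eq_rhs, (rule derivative_intros refl)+)
     (simp add: fun_eq_iff algebra_simps inner_commute)

lemma has_derivative_norm2:
  "((\<lambda>y. (norm (y - z))\<^sup>2) has_derivative (\<lambda>d. 2 * ((y - z) \<bullet> d))) (at y)"
  unfolding power2_norm_eq_inner
  by (rule has_derivative_eq_rhs, (rule derivative_intros refl)+)
     (simp add: fun_eq_iff algebra_simps inner_commute)

section \<open>Smoothness and strong convexity relative to the reference function\<close>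

locale bdgm_problem = smooth_convex f L3 for f :: "'a::euclidean_space \<Rightarrow> real" and L3 +
  fixes \<delta> \<xi> :: real and z :: 'a and Hz :: "'a \<Rightarrow>\<^sub>L 'a"
  assumes delta_pos: "0 < \<delta>" and xi_gt_1: "1 < \<xi>"
    and Hz_sym: "\<And>u w. Hz u \<bullet> w = u \<bullet> Hz w"
    and Hz_close: "norm (Hz - hess f z) \<le> \<delta>"
begin

abbreviation "F \<equiv> bdgm_obj f \<delta> L3 \<xi> z"
abbreviation "\<rho> \<equiv> bdgm_ref Hz \<delta> L3 \<xi> z"
abbreviation "lam \<equiv> bdgm_lambda \<delta> L3 \<xi> z"
abbreviation "it \<equiv> bdgm_iter f Hz \<delta> L3 \<xi> z"
abbreviation "C \<equiv> {y. norm (y - z) \<le> bdgm_radius f L3 \<xi> z}"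
text \<open>\<open>L\<close> and \<open>\<mu>\<close> are the constants of smoothness and of strong
  convexity of \<open>F\<close> relative to \<open>\<rho>\<close>.\<close>

abbreviation "L \<equiv> 1 + 1 / \<xi>"
abbreviation "\<mu> \<equiv> (1 - 1 / \<xi>) / 6"
definition "c4 = (\<xi> + \<xi>\<^sup>2) * L3 / 12"

lemma xi_pos: "0 < \<xi>"
  using xi_gt_1 by simp

lemma c4_pos: "0 < c4"
  using xi_pos L3_pos by (simp add: c4_def add_pos_pos)

lemma mu_bounds: "0 < \<mu>" "\<mu> \<le> L"
  using xi_gt_1 by (simp_all add: field_simps)

lemma hess_Hz: "\<bar>hess f z d \<bullet> d - Hz d \<bullet> d\<bar> \<le> \<delta> * (norm d)\<^sup>2"
proof -
  have "hess f z d \<bullet> d - Hz d \<bullet> d = - ((Hz - hess f z) d \<bullet> d)"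
    by (simp add: blinfun.diff_left inner_diff_left)
  also have "\<bar>\<dots>\<bar> \<le> norm ((Hz - hess f z) d) * norm d"
    using Cauchy_Schwarz_ineq2 by simp
  also have "\<dots> \<le> (norm (Hz - hess f z) * norm d) * norm d"
    by (intro mult_right_mono norm_blinfun) auto
  also have "\<dots> \<le> (\<delta> * norm d) * norm d"
    using Hz_close by (intro mult_right_mono) auto
  finally show ?thesis
    by (simp add: power2_eq_square mult.assoc)
qed


lemma has_derivative_ref:
  "(\<rho> has_derivative (\<lambda>d. (Hz (y - z) + (\<xi> * \<delta>) *\<^sub>R (y - z)
     + (4 * c4 * (norm (y - z))\<^sup>2) *\<^sub>R (y - z)) \<bullet> d)) (at y)"
  unfolding bdgm_ref_def[abs_def] c4_def[symmetric]
proof (rule has_derivative_eq_rhs,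
    (rule has_derivative_norm4 derivative_intros
       bounded_linear.has_derivative[OF blinfun.bounded_linear_right] refl)+,
    rule ext, goal_cases)
  case (1 d)
  have "Hz d \<bullet> (y - z) = Hz (y - z) \<bullet> d" "d \<bullet> (y - z) = (y - z) \<bullet> d"
    using Hz_sym[of d "y - z"] by (simp_all add: inner_commute)
  then show ?case
    by (simp add: inner_add_left inner_add_right inner_commute[of _ d] add_divide_distrib)
qed

lemma has_derivative_obj:
  "(F has_derivative (\<lambda>d. (grad f y + lam y *\<^sub>R (y - z)) \<bullet> d)) (at y)"
  unfolding bdgm_obj_def[abs_def] bdgm_lambda_def
proof (rule has_derivative_eq_rhs,
    (rule has_derivative_norm4 has_derivative_norm2 has_derivative_f derivative_intros refl)+,
    rule ext, goal_cases)
  case (1 d)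
  then show ?case
    using xi_pos by (simp add: inner_add_left) (simp add: field_simps)
qed

text \<open>\<open>hess_upper\<close>, always expanded at the centre \<open>z\<close>, is integrated
  twice along the segment from \<open>y\<close> to \<open>y + d\<close>. \<open>?Q''\<close> is that
  bound at parameter \<open>s\<close>, and \<open>?Q\<close> its second primitive that vanishes to
  first order at 0.\<close>

lemma bregman_f_upper:
  "bregman f y (y + d) \<le> L / 2 * (hess f z d \<bullet> d)
    + (1 + \<xi>) * L3 / 2 * ((norm d)\<^sup>2 * ((norm (y - z))\<^sup>2 / 2 + (y - z) \<bullet> d / 3 + (norm d)\<^sup>2 / 12))"
proof -
  let ?Q = "\<lambda>s. L / 2 * (hess f z d \<bullet> d) * s\<^sup>2 + (1 + \<xi>) * L3 / 2 * ((norm d)\<^sup>2 *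
    ((norm (y - z))\<^sup>2 / 2 * s\<^sup>2 + (y - z) \<bullet> d / 3 * s ^ 3 + (norm d)\<^sup>2 / 12 * s ^ 4))"
  let ?Q' = "\<lambda>s. L * (hess f z d \<bullet> d) * s + (1 + \<xi>) * L3 / 2 * ((norm d)\<^sup>2 *
    ((norm (y - z))\<^sup>2 * s + (y - z) \<bullet> d * s\<^sup>2 + (norm d)\<^sup>2 / 3 * s ^ 3))"
  let ?Q'' = "\<lambda>s. L * (hess f z d \<bullet> d) + (1 + \<xi>) * L3 / 2 * ((norm d)\<^sup>2 *
    ((norm (y - z))\<^sup>2 + 2 * ((y - z) \<bullet> d) * s + (norm d)\<^sup>2 * s\<^sup>2))"
  have "?Q 0 - f (y + 0 *\<^sub>R d) + (?Q' 0 - grad f (y + 0 *\<^sub>R d) \<bullet> d) \<le> ?Q 1 - f (y + 1 *\<^sub>R d)"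
  proof (rule second_order_tangent[where g = "\<lambda>s. ?Q s - f (y + s *\<^sub>R d)"
      and g' = "\<lambda>s. ?Q' s - grad f (y + s *\<^sub>R d) \<bullet> d"
      and g'' = "\<lambda>s. ?Q'' s - hess f (y + s *\<^sub>R d) d \<bullet> d"])
    fix s :: real
    have "(?Q has_real_derivative ?Q' s) (at s)"
      by (rule derivative_eq_intros refl | (simp add: field_simps; fail))+
    from DERIV_diff[OF this DERIV_f_line]
    show "((\<lambda>s. ?Q s - f (y + s *\<^sub>R d)) has_real_derivative ?Q' s - grad f (y + s *\<^sub>R d) \<bullet> d) (at s)" .
    have "(?Q' has_real_derivative ?Q'' s) (at s)"
      by (rule derivative_eq_intros refl | (simp add: field_simps; fail))+
    from DERIV_diff[OF this DERIV_grad_line]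
    show "((\<lambda>s. ?Q' s - grad f (y + s *\<^sub>R d) \<bullet> d) has_real_derivative
      ?Q'' s - hess f (y + s *\<^sub>R d) d \<bullet> d) (at s)" .
    have "(norm (y - z + s *\<^sub>R d))\<^sup>2
        = (norm (y - z))\<^sup>2 + 2 * ((y - z) \<bullet> d) * s + (norm d)\<^sup>2 * s\<^sup>2"
      unfolding power2_norm_eq_inner
      by (simp add: inner_add_left inner_add_right inner_commute power2_eq_square)
    with hess_upper[OF xi_pos, of z "y - z + s *\<^sub>R d" d]
    show "0 \<le> ?Q'' s - hess f (y + s *\<^sub>R d) d \<bullet> d"
      by (simp add: mult.commute mult.left_commute)
  qed
  then show ?thesis
    by (simp add: bregman_def)
qed


text \<open>
  Only a sixth of the lower bound on the Hessian is used: for \<open>\<xi> < 3\<close> the quartic term of the objective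
  cannot absorb the error of the whole bound.
\<close>

lemma bregman_f_lower:
  assumes "L' = 1 - 1 / \<xi>"
  shows "L' / 12 * (hess f z d \<bullet> d) - (1 + \<xi>) * L3 / 12 * ((norm d)\<^sup>2 *
      ((norm (y - z))\<^sup>2 / 2 + (y - z) \<bullet> d / 3 + (norm d)\<^sup>2 / 12)) \<le> bregman f y (y + d)"
proof -
  let ?Q = "\<lambda>s. L' / 12 * (hess f z d \<bullet> d) * s\<^sup>2 - (1 + \<xi>) * L3 / 12 * ((norm d)\<^sup>2 *
    ((norm (y - z))\<^sup>2 / 2 * s\<^sup>2 + (y - z) \<bullet> d / 3 * s ^ 3 + (norm d)\<^sup>2 / 12 * s ^ 4))"
  let ?Q' = "\<lambda>s. L' / 6 * (hess f z d \<bullet> d) * s - (1 + \<xi>) * L3 / 12 * ((norm d)\<^sup>2 *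
    ((norm (y - z))\<^sup>2 * s + (y - z) \<bullet> d * s\<^sup>2 + (norm d)\<^sup>2 / 3 * s ^ 3))"
  let ?Q'' = "\<lambda>s. L' / 6 * (hess f z d \<bullet> d) - (1 + \<xi>) * L3 / 12 * ((norm d)\<^sup>2 *
    ((norm (y - z))\<^sup>2 + 2 * ((y - z) \<bullet> d) * s + (norm d)\<^sup>2 * s\<^sup>2))"
  have "f (y + 0 *\<^sub>R d) - ?Q 0 + (grad f (y + 0 *\<^sub>R d) \<bullet> d - ?Q' 0) \<le> f (y + 1 *\<^sub>R d) - ?Q 1"
  proof (rule second_order_tangent[where g = "\<lambda>s. f (y + s *\<^sub>R d) - ?Q s"
      and g' = "\<lambda>s. grad f (y + s *\<^sub>R d) \<bullet> d - ?Q' s"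
      and g'' = "\<lambda>s. hess f (y + s *\<^sub>R d) d \<bullet> d - ?Q'' s"])
    fix s :: real
    have "(?Q has_real_derivative ?Q' s) (at s)"
      by (rule derivative_eq_intros refl | (simp add: field_simps; fail))+
    from DERIV_diff[OF DERIV_f_line this]
    show "((\<lambda>s. f (y + s *\<^sub>R d) - ?Q s) has_real_derivative grad f (y + s *\<^sub>R d) \<bullet> d - ?Q' s) (at s)" .
    have "(?Q' has_real_derivative ?Q'' s) (at s)"
      by (rule derivative_eq_intros refl | (simp add: field_simps; fail))+
    from DERIV_diff[OF DERIV_grad_line this]
    show "((\<lambda>s. grad f (y + s *\<^sub>R d) \<bullet> d - ?Q' s) has_real_derivative
      hess f (y + s *\<^sub>R d) d \<bullet> d - ?Q'' s) (at s)" .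
    have n2: "(norm (y - z + s *\<^sub>R d))\<^sup>2
        = (norm (y - z))\<^sup>2 + 2 * ((y - z) \<bullet> d) * s + (norm d)\<^sup>2 * s\<^sup>2"
      unfolding power2_norm_eq_inner
      by (simp add: inner_add_left inner_add_right inner_commute power2_eq_square)
    have "?Q'' s = (L' * (hess f z d \<bullet> d)
        - (1 + \<xi>) * L3 / 2 * (norm (y - z + s *\<^sub>R d))\<^sup>2 * (norm d)\<^sup>2) / 6"
      unfolding n2 by (simp add: diff_divide_distrib mult.commute mult.left_commute)
    \<comment> \<open>A sixth of a lower bound is again a lower bound because the Hessian form is
      nonnegative.\<close>
    moreover have "\<dots> \<le> hess f (y + s *\<^sub>R d) d \<bullet> d"
      using hess_lower[OF xi_pos, of z d "y - z + s *\<^sub>R d"] hess_nonneg[of "y + s *\<^sub>R d" d] assms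
      by simp
    ultimately show "0 \<le> hess f (y + s *\<^sub>R d) d \<bullet> d - ?Q'' s"
      by linarith
  qed
  then show ?thesis
    by (simp add: bregman_def)
qed

lemma grad_ref: "grad \<rho> y = Hz (y - z) + (\<xi> * \<delta>) *\<^sub>R (y - z) + (4 * c4 * (norm (y - z))\<^sup>2) *\<^sub>R (y - z)"
  by (rule grad_eqI[OF has_derivative_ref])

lemma grad_obj: "grad F y = grad f y + lam y *\<^sub>R (y - z)"
  by (rule grad_eqI[OF has_derivative_obj])

lemma bregman_ref:
  "bregman \<rho> y (y + d) = 1 / 2 * (Hz d \<bullet> d + \<xi> * \<delta> * (norm d)\<^sup>2) + c4 * breg4 (y - z) d"
proof -
  have h: "y + d - z = (y - z) + d"
    by simp
  have "Hz d \<bullet> (y - z) = Hz (y - z) \<bullet> d" "d \<bullet> (y - z) = (y - z) \<bullet> d"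
    using Hz_sym[of d "y - z"] by (simp_all add: inner_commute)
  then show ?thesis
    unfolding bregman_def grad_ref bdgm_ref_def c4_def[symmetric] h breg4_eq[symmetric]
    by (simp add: blinfun.add_right inner_add_left inner_add_right power2_norm_eq_inner ring_distribs add_divide_distrib diff_divide_distrib mult_ac)
qed

lemma bregman_obj:
  "bregman F y (y + d) = bregman f y (y + d) + (\<xi>\<^sup>2 - 1) * \<delta> / (2 * \<xi>) * (norm d)\<^sup>2
     + (1 + \<xi>) * \<xi> * L3 / 24 * breg4 (y - z) d"
proof -
  have h: "y + d - z = (y - z) + d"
    by simp
  have n2: "(norm (y - z + d))\<^sup>2 = (norm (y - z))\<^sup>2 + 2 * ((y - z) \<bullet> d) + (norm d)\<^sup>2"
    unfolding power2_norm_eq_inner by (simp add: inner_add_left inner_add_right inner_commute)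
  show ?thesis
    unfolding bregman_def grad_obj bdgm_obj_def bdgm_lambda_def h breg4_eq[symmetric] n2
    by (simp add: inner_add_left ring_distribs add_divide_distrib diff_divide_distrib mult_ac)
qed

text \<open>Quadratic and quartic parts are compared separately. In the quadratic part the estimator
  error and the two \<open>\<delta>\<close> terms balance exactly; the quartic part needs
  \<open>\<xi>\<close> to be at least 1.\<close>

lemma relative_smoothness: "bregman F y (y + d) \<le> L * bregman \<rho> y (y + d)"
proof -
  let ?D = "(norm d)\<^sup>2"
  define b where "b = breg4 (y - z) d"
  define T where "T = ?D * ((norm (y - z))\<^sup>2 / 2 + (y - z) \<bullet> d / 3 + ?D / 12)"
  define P where "P = (1 + \<xi>) * L3"
  have xi_P: "(1 + \<xi>) * \<xi> * L3 / 24 * b = P * b * \<xi> / 24"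
    by (simp add: P_def)
  have P: "0 \<le> P"
    using xi_pos L3_pos by (simp add: P_def)
  have "P * T \<le> P * b / 4"
    using mult_left_mono[OF breg4_taylor[of d "y - z"] P] unfolding T_def b_def by simp
  moreover have "P * b \<le> P * b * \<xi>"
    using mult_left_mono[of 1 \<xi> "P * b"] xi_gt_1 P breg4_nonneg[of "y - z" d]
    by (simp add: b_def)
  moreover have Lc: "L * (c4 * b) = (P * b + P * b * \<xi>) / 12"
    using xi_pos by (simp add: P_def c4_def field_simps power2_eq_square)
  ultimately have quartic: "P * T / 2 + P * b * \<xi> / 24 \<le> L * (c4 * b)"
    unfolding Lc by argo
  have "L / 2 * (hess f z d \<bullet> d) + (\<xi>\<^sup>2 - 1) * \<delta> / (2 * \<xi>) * ?D
      \<le> L * (1 / 2 * (Hz d \<bullet> d + \<xi> * \<delta> * ?D))"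
  proof -
    have "L / 2 * (hess f z d \<bullet> d) \<le> L / 2 * (Hz d \<bullet> d + \<delta> * ?D)"
      using hess_Hz[of d] xi_pos by (intro mult_left_mono) auto
    moreover have "L / 2 * (Hz d \<bullet> d + \<delta> * ?D) + (\<xi>\<^sup>2 - 1) * \<delta> / (2 * \<xi>) * ?D
        = L * (1 / 2 * (Hz d \<bullet> d + \<xi> * \<delta> * ?D))"
      using xi_pos by (simp add: field_simps power2_eq_square)
    ultimately show ?thesis
      by linarith
  qed
  then show ?thesis
    unfolding bregman_obj bregman_ref distrib_left[of L] b_def[symmetric] xi_P
    using bregman_f_upper[of y d, folded P_def T_def, unfolded times_divide_eq_left] quartic by linarith
qed

text \<open>Again quadratic and quartic parts separately. The quadratic part leaves a surplus, the
  multiple of \<open>\<delta>\<close> shown to be nonnegative below.\<close>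

lemma relative_strong_convexity: "\<mu> * bregman \<rho> y (y + d) \<le> bregman F y (y + d)"
proof -
  let ?D = "(norm d)\<^sup>2"
  define b where "b = breg4 (y - z) d"
  define T where "T = ?D * ((norm (y - z))\<^sup>2 / 2 + (y - z) \<bullet> d / 3 + ?D / 12)"
  define P where "P = (1 + \<xi>) * L3"
  have xi_P: "(1 + \<xi>) * \<xi> * L3 / 24 * b = P * b * \<xi> / 24"
    by (simp add: P_def)
  have P: "0 \<le> P"
    using xi_pos L3_pos by (simp add: P_def)
  have "P * T \<le> P * b / 4"
    using mult_left_mono[OF breg4_taylor[of d "y - z"] P] unfolding T_def b_def by simp
  moreover have "P * b \<le> P * b * \<xi>" "0 \<le> P * b"
    using mult_left_mono[of 1 \<xi> "P * b"] xi_gt_1 P breg4_nonneg[of "y - z" d]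
    by (simp_all add: b_def)
  moreover have Lc: "\<mu> * (c4 * b) = (P * b * \<xi> - P * b) / 72"
    using xi_pos by (simp add: P_def c4_def field_simps power2_eq_square)
  ultimately have quartic: "P * T / 12 + \<mu> * (c4 * b) \<le> P * b * \<xi> / 24"
    unfolding Lc by (simp add: field_simps)
  have "\<mu> * (1 / 2 * (Hz d \<bullet> d + \<xi> * \<delta> * ?D))
      \<le> (1 - 1 / \<xi>) / 12 * (hess f z d \<bullet> d) + (\<xi>\<^sup>2 - 1) * \<delta> / (2 * \<xi>) * ?D"
  proof -
    have "(1 - 1 / \<xi>) / 12 * (Hz d \<bullet> d - \<delta> * ?D) \<le> (1 - 1 / \<xi>) / 12 * (hess f z d \<bullet> d)"
      using hess_Hz[of d] xi_gt_1 by (intro mult_left_mono) auto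
    moreover have "(1 - 1 / \<xi>) / 12 * (Hz d \<bullet> d - \<delta> * ?D) + (\<xi>\<^sup>2 - 1) * \<delta> / (2 * \<xi>) * ?D
        = \<mu> * (1 / 2 * (Hz d \<bullet> d + \<xi> * \<delta> * ?D)) + 5 * (\<xi> - 1) * (\<xi> + 1) / (12 * \<xi>) * \<delta> * ?D"
      using xi_pos by (simp add: field_simps power2_eq_square)
    moreover have "0 \<le> 5 * (\<xi> - 1) * (\<xi> + 1) / (12 * \<xi>) * \<delta> * ?D"
      using xi_gt_1 delta_pos by simp
    ultimately show ?thesis
      by linarith
  qed
  then show ?thesis
    unfolding bregman_obj bregman_ref distrib_left[of \<mu>] b_def[symmetric] xi_P
    using bregman_f_lower[OF refl, of d y, folded P_def T_def, unfolded times_divide_eq_left] quartic by linarith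
qed

text \<open>Since the true Hessian is nonnegative, \<open>Hz\<close> is at least
  \<open>- \<delta>\<close>, so the shift by \<open>\<xi> * \<delta>\<close> leaves
  \<open>(\<xi> - 1) * \<delta>\<close>. The quartic part is \<open>breg4_lower\<close>.\<close>

lemma bregman_ref_lower:
  "((\<xi> - 1) * \<delta> / 2 + c4 / 4 * (norm (y + d - z))\<^sup>2) * (norm d)\<^sup>2 \<le> bregman \<rho> y (y + d)"
proof -
  have "c4 / 4 * (norm (y - z + d))\<^sup>2 * (norm d)\<^sup>2 \<le> c4 * breg4 (y - z) d"
    using mult_left_mono[OF breg4_lower[of "y - z" d], of c4] c4_pos by simp
  moreover have "y - z + d = y + d - z"
    by simp
  ultimately have "c4 / 4 * (norm (y + d - z))\<^sup>2 * (norm d)\<^sup>2 \<le> c4 * breg4 (y - z) d"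
    by simp
  moreover have "(\<xi> - 1) * \<delta> / 2 * (norm d)\<^sup>2 \<le> 1 / 2 * (Hz d \<bullet> d + \<xi> * \<delta> * (norm d)\<^sup>2)"
    using hess_Hz[of d] hess_nonneg[of z d] by (simp add: algebra_simps)
  ultimately show ?thesis
    unfolding bregman_ref distrib_right[of _ _ "(norm d)\<^sup>2"] by linarith
qed

lemma bregman_ref_upper:
  assumes "norm (y - z) \<le> 2 * r" "norm d \<le> r"
  shows "bregman \<rho> y (y + d)
    \<le> ((norm (hess f z) + \<delta> + \<xi> * \<delta>) / 2 + 33 * c4 * r\<^sup>2) * (norm d)\<^sup>2"
proof -
  have "hess f z d \<bullet> d \<le> norm (hess f z) * norm d * norm d"
    using norm_cauchy_schwarz[of "hess f z d" d] norm_blinfun[of "hess f z" d]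
    by (meson mult_right_mono norm_ge_zero order_trans)
  with hess_Hz[of d]
  have "1 / 2 * (Hz d \<bullet> d + \<xi> * \<delta> * (norm d)\<^sup>2)
      \<le> (norm (hess f z) + \<delta> + \<xi> * \<delta>) / 2 * (norm d)\<^sup>2"
    by (simp add: power2_eq_square algebra_simps)
  moreover have "c4 * breg4 (y - z) d \<le> 33 * c4 * r\<^sup>2 * (norm d)\<^sup>2"
    using mult_left_mono[OF breg4_upper[OF assms], of c4] c4_pos by simp
  ultimately show ?thesis
    unfolding bregman_ref distrib_right[of _ "33 * c4 * r\<^sup>2"] by linarith
qed

section \<open>Optimality of the subroutine steps and the minimizer of the objective\<close>

lemma continuous_ref: "continuous_on S \<rho>"
  using has_derivative_ref by (meson continuous_at_imp_continuous_on has_derivative_continuous)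

lemma continuous_obj: "continuous_on S F"
  using has_derivative_obj by (meson continuous_at_imp_continuous_on has_derivative_continuous)

lemma ball_eq: "C = cball z (bdgm_radius f L3 \<xi> z)"
  by (auto simp: dist_norm norm_minus_commute)

lemma radius_nonneg: "0 \<le> bdgm_radius f L3 \<xi> z"
  using L3_pos xi_gt_1 by (simp add: bdgm_radius_def)

text \<open>The variational inequality of a step: the bracket is the gradient of the minimized model
  at its minimizer on the ball.\<close>

lemma iter_optimal:
  assumes "w \<in> C"
  shows "0 \<le> (grad F (it k) + (2 * L) *\<^sub>R (grad \<rho> (it (Suc k)) - grad \<rho> (it k))) \<bullet> (w - it (Suc k))"
proof -
  let ?l = "\<lambda>y. grad F (it k) \<bullet> (y - it k) + 2 * L * bregman \<rho> (it k) y"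
  have *: "it (Suc k) = arg_min_on ?l C"
    by (simp add: Let_def)
  have "\<exists>x\<in>C. \<forall>y\<in>C. ?l x \<le> ?l y"
    unfolding ball_eq bregman_def using radius_nonneg
    by (intro continuous_attains_inf) (auto intro!: continuous_intros continuous_ref)
  note min = is_arg_min_arg_min_on[OF this, folded *]
  have "(?l has_derivative (\<lambda>h. (grad F (it k) + (2 * L) *\<^sub>R (grad \<rho> (it (Suc k)) - grad \<rho> (it k))) \<bullet> h))
      (at (it (Suc k)))"
    unfolding bregman_def
    by (rule has_derivative_eq_rhs,
        (rule has_derivative_ref[of "it (Suc k)", folded grad_ref] derivative_intros refl)+)
       (simp add: fun_eq_iff inner_add_left inner_diff_left del: bdgm_iter.simps)
  from minimum_on_convex_derivative[OF _ min(1) assms this min(2)]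
  show ?thesis
    using convex_cball unfolding ball_eq by blast
qed

text \<open>The radius is so large that outside the ball the quartic term outweighs the linear term
  of \<open>f\<close> at \<open>z\<close>. Hence the minimizer on the compact ball is global and its
  gradient vanishes.\<close>

lemma obtain_minimizer:
  obtains w where "w \<in> C" "\<And>y. F w \<le> F y" "grad F w = 0"
proof -
  have "\<exists>x\<in>C. \<forall>y\<in>C. F x \<le> F y"
    unfolding ball_eq using radius_nonneg
    by (intro continuous_attains_inf) (auto intro!: continuous_obj)
  then obtain w where w: "w \<in> C" "\<And>y. y \<in> C \<Longrightarrow> F w \<le> F y"
    by blast
  have min: "F w \<le> F y" for y
  proof (cases "y \<in> C")
    case False
    let ?h = "norm (y - z)" and ?R = "bdgm_radius f L3 \<xi> z" and ?g = "norm (grad f z)"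
    have R3: "?R ^ 3 = 96 * ?g / (L3 * (\<xi>\<^sup>2 - 1))"
      using L3_pos xi_gt_1
      by (simp add: bdgm_radius_def power_mult_distrib odd_real_root_pow)
    have h: "?R < ?h"
      using False by simp
    have "?g \<le> (1 + \<xi>) * \<xi> * L3 / 24 * ?R ^ 3"
    proof -
      have "(\<xi> - 1) * ?g \<le> 4 * \<xi> * ?g"
        using xi_gt_1 by (intro mult_right_mono) auto
      then have "?g \<le> 4 * \<xi> * ?g / (\<xi> - 1)"
        using xi_gt_1 by (simp add: pos_le_divide_eq mult.commute)
      moreover have "(1 + \<xi>) * \<xi> * L3 / 24 * ?R ^ 3 = 4 * \<xi> * ?g / (\<xi> - 1)"
      proof -
        have "\<xi>\<^sup>2 - 1 = (1 + \<xi>) * (\<xi> - 1)"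
          by (simp add: power2_eq_square algebra_simps)
        then show ?thesis
          unfolding R3 using L3_pos xi_gt_1 by simp
      qed
      ultimately show ?thesis
        by (simp only:)
    qed
    also have "\<dots> \<le> (1 + \<xi>) * \<xi> * L3 / 24 * ?h ^ 3"
      using h radius_nonneg L3_pos xi_pos by (intro mult_left_mono power_mono) auto
    finally have "?g * ?h \<le> (1 + \<xi>) * \<xi> * L3 / 24 * ?h ^ 3 * ?h"
      by (rule mult_right_mono) simp
    then have "?g * ?h \<le> (1 + \<xi>) * \<xi> * L3 / 24 * ?h ^ 4"
      by (simp add: power_Suc[of _ 3, simplified] mult_ac)
    moreover have "- (?g * ?h) \<le> grad f z \<bullet> (y - z)"
      using Cauchy_Schwarz_ineq2[of "grad f z" "y - z"] by (simp add: abs_if split: if_splits)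
    moreover have "0 \<le> (\<xi>\<^sup>2 - 1) * \<delta> / (2 * \<xi>) * ?h\<^sup>2"
      using xi_gt_1 delta_pos by simp
    ultimately have "F z \<le> F y"
      using grad_inequality[of z y] unfolding bdgm_obj_def by simp
    moreover have "F w \<le> F z"
      using w(2)[of z] radius_nonneg by simp
    ultimately show ?thesis
      by simp
  qed (use w in simp)
  \<comment> \<open>First-order optimality on the whole space, tested in the direction of the
    negative gradient.\<close>
  have "0 \<le> grad F w \<bullet> ((w - grad F w) - w)"
    by (rule minimum_on_convex_derivative[of UNIV w "w - grad F w" F, OF _ _ _ has_derivative_obj[of w, folded grad_obj]])
       (auto intro: min)
  then have "grad F w = 0"
    using inner_ge_zero[of "grad F w"] by simp
  with w min show thesis
    using that by blast
qed

section \<open>Convergence of the subroutine\<close>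

text \<open>The iteration count will depend only on \<open>\<omega>\<close> and on \<open>X\<close>,
  which measures the Hessian at \<open>z\<close> against \<open>\<delta>\<close>.\<close>

abbreviation "\<omega> \<equiv> \<xi> / (\<xi> - 1)"
abbreviation "X \<equiv> 1 + norm (hess f z) / \<delta>"

lemma omega_ge_1: "1 \<le> \<omega>"
  using xi_gt_1 by simp

lemma X_ge_1: "1 \<le> X"
  using delta_pos by simp

text \<open>Optimality and the three-point identity are combined with smoothness at the new iterate
  and strong convexity at the minimizer. The factor 2 in front of \<open>L\<close> more than pays
  for the smoothness term.\<close>

lemma contraction:
  assumes "w \<in> C" "\<And>y. F w \<le> F y"
  shows "bregman \<rho> (it (Suc k)) w \<le> (1 - 1 / (24 * \<omega>)) * bregman \<rho> (it k) w"
proof -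
  let ?a = "it k" and ?b = "it (Suc k)"
  note [simp del] = bdgm_iter.simps
  have nn: "0 \<le> bregman \<rho> u v" for u v
  proof -
    have "0 \<le> ((\<xi> - 1) * \<delta> / 2 + c4 / 4 * (norm (u + (v - u) - z))\<^sup>2) * (norm (v - u))\<^sup>2"
      using xi_gt_1 delta_pos c4_pos by simp
    also note bregman_ref_lower
    finally show ?thesis
      by simp
  qed
  have opt: "0 \<le> grad F ?a \<bullet> (w - ?b)
      + 2 * L * (bregman \<rho> ?a w - bregman \<rho> ?a ?b - bregman \<rho> ?b w)"
    using iter_optimal[OF assms(1), of k]
    unfolding bregman_three_point by (simp add: inner_add_left)
  have smooth: "F ?b - F ?a - grad F ?a \<bullet> (?b - ?a) \<le> L * bregman \<rho> ?a ?b"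
    using relative_smoothness[of ?a "?b - ?a"] by (simp add: bregman_def)
  have strong: "\<mu> * bregman \<rho> ?a w \<le> F w - F ?a - grad F ?a \<bullet> (w - ?a)"
    using relative_strong_convexity[of ?a "w - ?a"] by (simp add: bregman_def)
  have "0 \<le> L * bregman \<rho> ?a ?b"
    using nn xi_pos by simp
  moreover have "2 * L * (bregman \<rho> ?a w - bregman \<rho> ?a ?b - bregman \<rho> ?b w)
      = 2 * L * bregman \<rho> ?a w - 2 * (L * bregman \<rho> ?a ?b) - 2 * L * bregman \<rho> ?b w"
    by (simp only: right_diff_distrib mult.assoc)
  ultimately have "2 * L * bregman \<rho> ?b w \<le> 2 * L * bregman \<rho> ?a w - \<mu> * bregman \<rho> ?a w"
    using opt smooth strong assms(2)[of ?b] unfolding inner_diff_right by linarith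
  then have "bregman \<rho> ?b w \<le> (2 * L * bregman \<rho> ?a w - \<mu> * bregman \<rho> ?a w) / (2 * L)"
    using xi_pos by (subst pos_le_divide_eq) (auto simp: mult_ac add_pos_pos)
  also have "\<dots> = (1 - \<mu> / (2 * L)) * bregman \<rho> ?a w"
  proof -
    have "(l * b - m * b) / l = (1 - m / l) * b" if "l \<noteq> 0" for l m b :: real
      using that by (simp add: field_simps)
    moreover have "0 < L"
      using mu_bounds by (rule less_le_trans)
    then have "2 * L \<noteq> 0"
      by simp
    ultimately show ?thesis
      by blast
  qed
  also have "\<dots> \<le> (1 - 1 / (24 * \<omega>)) * bregman \<rho> ?a w"
  \<comment> \<open>The exact rate \<open>\<mu> / (2 * L)\<close> equals
    \<open>(\<xi> - 1) / (12 * (\<xi> + 1))\<close>, and \<open>\<xi> + 1\<close> is at most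
    \<open>2 * \<xi>\<close>.\<close>
  proof (intro mult_right_mono nn)
    have "1 / (24 * \<omega>) = (\<xi> - 1) / (24 * \<xi>)"
      by simp
    also have "\<dots> \<le> (\<xi> - 1) / (12 * (\<xi> + 1))"
      using xi_gt_1 by (intro divide_left_mono) auto
    also have "\<dots> = ((\<xi> - 1) / (6 * \<xi>)) / (2 * (\<xi> + 1) / \<xi>)"
      using xi_gt_1 by simp
    also have "(\<xi> - 1) / (6 * \<xi>) = \<mu>"
      using xi_gt_1 by (simp add: field_simps)
    also have "2 * (\<xi> + 1) / \<xi> = 2 * L"
      using xi_gt_1 by (simp add: field_simps)
    finally show "1 - \<mu> / (2 * L) \<le> 1 - 1 / (24 * \<omega>)"
      by simp
  qed
  finally show ?thesis .
qed

text \<open>At distance \<open>e\<close> from the minimizer the gradient of \<open>F\<close> is at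
  most \<open>4 * K * e\<close>, while the stopping condition tolerates \<open>lam / 2 * h\<close>,
  which is at least \<open>B / 2 * r\<close>. As \<open>K\<close> is at most
  \<open>134 * (\<omega> * X) * B\<close>, it suffices that \<open>1072 * (\<omega> * X) * e\<close>
  is at most \<open>r\<close>, where 1072 is \<open>2 * 4 * 134\<close>. Squaring costs a further
  factor \<open>134 * (\<omega> * X)\<close>, and \<open>134 * 1072\<^sup>2\<close> is below
  \<open>2 ^ 28\<close>.\<close>

lemma bdgm_stop_if:
  assumes small: "(1 - 1 / (24 * \<omega>)) ^ k * (2 ^ 28 * (\<omega> * X) ^ 3) \<le> 1"
  shows "\<exists>j\<le>k. bdgm_stop f Hz \<delta> L3 \<xi> z j"
proof -
  obtain w where w: "w \<in> C" "\<And>y. F w \<le> F y" "grad F w = 0"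
    using obtain_minimizer by blast
  define q where "q = 1 - 1 / (24 * \<omega>)"
  have q: "0 \<le> q"
    using xi_gt_1 by (simp add: q_def field_simps)
  have contr: "bregman \<rho> (it j) w \<le> q ^ j * bregman \<rho> z w" for j
  proof (induction j)
    case (Suc j)
    have "bregman \<rho> (it (Suc j)) w \<le> q * bregman \<rho> (it j) w"
      using contraction[OF w(1,2)] by (simp only: q_def)
    also have "\<dots> \<le> q * (q ^ j * bregman \<rho> z w)"
      using q Suc by (intro mult_left_mono)
    finally show ?case
      by (simp only: power_Suc mult.assoc)
  qed simp
  define r e where "r = norm (w - z)" and "e = norm (w - it k)"
  show ?thesis
  proof (cases "w = z")
    case True
    then have "grad f z = 0"
      using w(3) by (simp add: grad_obj)
    then have "bdgm_stop f Hz \<delta> L3 \<xi> z 0"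
      by (simp add: bdgm_stop_def ms_condition_def)
    then show ?thesis
      by blast
  next
    case False
    then have r: "0 < r"
      by (simp add: r_def)
    \<comment> \<open>Lower and upper curvature of \<open>\<rho>\<close> at scale \<open>r\<close>
      around \<open>z\<close>.\<close>
    define B K where "B = (\<xi> - 1) * \<delta> / 2 + c4 / 4 * r\<^sup>2"
      and "K = (norm (hess f z) + \<delta> + \<xi> * \<delta>) / 2 + 33 * c4 * r\<^sup>2"
    have B: "0 < B"
      using xi_gt_1 delta_pos c4_pos r by (simp add: B_def add_pos_nonneg)
    have K: "0 < K"
      using xi_gt_1 delta_pos c4_pos r by (simp add: K_def add_pos_nonneg add_nonneg_pos)
    have wX: "1 \<le> \<omega> * X"
      using mult_mono[OF omega_ge_1 X_ge_1] omega_ge_1 by simp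
    \<comment> \<open>The quartic coefficients have ratio \<open>4 * 33\<close>, slightly less than
      134; the quadratic parts would need only the factor 2.\<close>
    have KB: "K \<le> 134 * (\<omega> * X) * B"
    proof -
      define W where "W = \<omega> * X"
      have W: "1 \<le> W"
        using wX by (simp only: W_def)
      have "33 * c4 * r\<^sup>2 \<le> 33 * (W * (c4 * r\<^sup>2))"
        using mult_right_mono[OF W, of "c4 * r\<^sup>2"] c4_pos by simp
      also have "\<dots> \<le> 67 / 2 * (W * (c4 * r\<^sup>2))"
        using W c4_pos by (intro mult_right_mono) auto
      finally have quartic: "33 * c4 * r\<^sup>2 \<le> 67 / 2 * (W * (c4 * r\<^sup>2))" .
      have "norm (hess f z) + \<delta> + \<xi> * \<delta> \<le> 2 * \<xi> * (\<delta> * X)"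
      proof -
        have dX: "\<delta> * X = \<delta> + norm (hess f z)"
          using delta_pos by (simp add: field_simps)
        have "norm (hess f z) \<le> \<xi> * norm (hess f z)" "\<delta> \<le> \<xi> * \<delta>" "0 \<le> \<xi> * norm (hess f z)"
          using xi_gt_1 delta_pos by (simp_all add: mult_le_cancel_right1)
        moreover have "2 * \<xi> * (\<delta> + norm (hess f z)) = 2 * (\<xi> * \<delta>) + 2 * (\<xi> * norm (hess f z))"
          by (simp add: algebra_simps)
        ultimately show ?thesis
          unfolding dX by linarith
      qed
      also have "\<dots> = 2 * (W * ((\<xi> - 1) * \<delta>))"
        using xi_gt_1 by (simp add: W_def field_simps)
      also have "\<dots> \<le> 134 * (W * ((\<xi> - 1) * \<delta>))"
        using xi_gt_1 W delta_pos by (intro mult_right_mono) auto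
      finally have "(norm (hess f z) + \<delta> + \<xi> * \<delta>) / 2 \<le> 67 * (W * ((\<xi> - 1) * \<delta>))"
        by simp
      from add_mono[OF this quartic]
      have "K \<le> 67 * (W * ((\<xi> - 1) * \<delta>)) + 67 / 2 * (W * (c4 * r\<^sup>2))"
        by (simp only: K_def)
      also have "\<dots> = 134 * W * B"
        by (simp add: B_def field_simps)
      finally show ?thesis
        by (simp only: W_def)
    qed
    have up: "bregman \<rho> u (u + d) \<le> K * (norm d)\<^sup>2"
      if "norm (u - z) \<le> 2 * r" "norm d \<le> r" for u d
      using bregman_ref_upper[OF that] by (simp only: K_def)
    have "B * e\<^sup>2 \<le> bregman \<rho> (it k) w"
      using bregman_ref_lower[of "it k" "w - it k"] by (simp add: B_def r_def e_def)
    also have "\<dots> \<le> q ^ k * bregman \<rho> z w"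
      by (rule contr)
    also have "\<dots> \<le> q ^ k * (K * r\<^sup>2)"
      using up[of z "w - z"] q r by (intro mult_left_mono) (simp_all add: r_def)
    also have "\<dots> \<le> q ^ k * (134 * (\<omega> * X) * B * r\<^sup>2)"
      using q KB by (intro mult_left_mono mult_right_mono) auto
    finally have "B * e\<^sup>2 \<le> B * (q ^ k * (134 * (\<omega> * X)) * r\<^sup>2)"
      by (simp only: mult_ac)
    then have "e\<^sup>2 \<le> q ^ k * (134 * (\<omega> * X)) * r\<^sup>2"
      using B by (rule mult_left_le_imp_le)
    then have "e\<^sup>2 * (1072 * (\<omega> * X))\<^sup>2 \<le> q ^ k * (134 * (\<omega> * X)) * r\<^sup>2 * (1072 * (\<omega> * X))\<^sup>2"
      by (rule mult_right_mono) simp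
    also have "\<dots> = (134 * 1072\<^sup>2 / 2 ^ 28) * (q ^ k * (2 ^ 28 * (\<omega> * X) ^ 3)) * r\<^sup>2"
    proof -
      have "a * (134 * u) * b * (1072 * u)\<^sup>2 = (134 * 1072\<^sup>2 / 2 ^ 28) * (a * (2 ^ 28 * u ^ 3)) * b"
        for a b u :: real
        by (simp add: power2_eq_square power3_eq_cube)
      then show ?thesis .
    qed
    also have "\<dots> \<le> 1 * 1 * r\<^sup>2"
      using small q wX unfolding q_def[symmetric]
      by (intro mult_mono mult_right_mono) auto
    finally have "(e * (1072 * (\<omega> * X)))\<^sup>2 \<le> r\<^sup>2"
      unfolding power_mult_distrib[of e] by simp
    then have er: "e * (1072 * (\<omega> * X)) \<le> r"
      by (rule power2_le_imp_le) (simp add: r less_imp_le)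
    have e: "0 \<le> e"
      by (simp add: e_def)
    have e_half: "e \<le> r / 2"
    proof -
      have "e * 1072 \<le> e * (1072 * u)" if "1 \<le> u" for u
        using that e by (intro mult_left_mono) auto
      from order_trans[OF this[OF wX] er] e show ?thesis
        by simp
    qed
    define h where "h = norm (it k - z)"
    have h: "r / 2 \<le> h" "h \<le> 2 * r"
      using e_half norm_triangle_ineq[of "w - it k" "it k - z"]
        norm_triangle_ineq[of "it k - w" "w - z"] norm_minus_commute[of w "it k"] r
      by (auto simp: r_def e_def h_def)
    \<comment> \<open>The gradient of \<open>F\<close> vanishes at \<open>w\<close>, so the gap is a
      Bregman distance.\<close>
    have gap: "F (it k) - F w \<le> L * (K * e\<^sup>2)"
    proof -
      have "F (it k) - F w = bregman F w (w + (it k - w))"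
        using w(3) by (simp add: bregman_def)
      also have "\<dots> \<le> L * bregman \<rho> w (w + (it k - w))"
        by (rule relative_smoothness)
      also have "\<dots> \<le> L * (K * (norm (it k - w))\<^sup>2)"
      proof (intro mult_left_mono up)
        show "norm (w - z) \<le> 2 * r" "norm (it k - w) \<le> r"
          using e_half r unfolding r_def e_def norm_minus_commute[of "it k"] by linarith+
      qed (use xi_pos in simp)
      finally show ?thesis
        by (simp add: e_def norm_minus_commute)
    qed
    let ?G = "grad F (it k)"
    have grad_le: "norm ?G \<le> 4 * K * e"
    proof (cases "?G = 0 \<or> e = 0")
      case True
      then have "?G = 0"
        using w(3) by (auto simp: e_def)
      then show ?thesis
        using K e by simp
    next
      case False
      \<comment> \<open>A gradient step of length \<open>e\<close> stays where \<open>K\<close>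
        bounds the curvature. It cannot go below \<open>F w\<close>, so the gap bounds the
        gradient.\<close>
      define d where "d = (- (e / norm ?G)) *\<^sub>R ?G"
      have nd: "norm d = e"
        using False e by (simp add: d_def)
      have "bregman F (it k) (it k + d) \<le> L * (K * e\<^sup>2)"
      proof -
        have "bregman \<rho> (it k) (it k + d) \<le> K * e\<^sup>2"
          using up[of "it k" d] h e_half e unfolding nd h_def by simp
        from mult_left_mono[OF this, of L] relative_smoothness[of "it k" d] xi_pos
        show ?thesis
          by simp
      qed
      moreover have "?G \<bullet> d = - (e * norm ?G)"
        using False by (simp add: d_def power2_norm_eq_inner[symmetric] power2_eq_square)
      ultimately have "e * norm ?G \<le> 2 * (L * (K * e\<^sup>2))"
        using gap w(2)[of "it k + d"] unfolding bregman_def add_diff_cancel_left' by linarith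
      also have "\<dots> = e * (L * (2 * K * e))"
        by (simp only: power2_eq_square mult_ac)
      finally have "norm ?G \<le> L * (2 * K * e)"
        by (rule mult_left_le_imp_le) (use False e in simp)
      also have "\<dots> \<le> 2 * (2 * K * e)"
        using xi_gt_1 K e by (intro mult_right_mono) auto
      finally show ?thesis
        by simp
    qed
    have lam_ge: "2 * B \<le> lam (it k)"
    proof -
      have "c4 / 2 * r\<^sup>2 \<le> 2 * c4 * h\<^sup>2"
        using power_mono[OF h(1), of 2] r c4_pos by (simp add: power_divide field_simps)
      moreover have "(\<xi> - 1) * \<delta> \<le> (\<xi>\<^sup>2 - 1) / \<xi> * \<delta>"
        using xi_gt_1 delta_pos by (intro mult_right_mono) (auto simp: field_simps power2_eq_square)
      moreover have "lam (it k) = (\<xi>\<^sup>2 - 1) / \<xi> * \<delta> + 2 * c4 * h\<^sup>2"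
        by (simp add: bdgm_lambda_def c4_def h_def field_simps power2_eq_square)
      ultimately show ?thesis
        by (simp add: B_def)
    qed
    have "norm ?G \<le> 4 * (134 * (\<omega> * X) * B) * e"
      using grad_le mult_right_mono[OF KB e] by simp
    also have "\<dots> = B / 2 * (e * (1072 * (\<omega> * X)))"
      by simp
    also have "\<dots> \<le> B / 2 * r"
      using er B by (intro mult_left_mono) auto
    also have "\<dots> \<le> lam (it k) / 2 * h"
      using lam_ge h r B mult_mono[of B "lam (it k) / 2" "r / 2" h] by simp
    finally have "bdgm_stop f Hz \<delta> L3 \<xi> z k"
      by (simp add: bdgm_stop_def ms_condition_def grad_obj h_def)
    then show ?thesis
      by blast
  qed
qed

text \<open>The geometric factor to the power \<open>k\<close> is at most
  \<open>exp (- k / (24 * \<omega>))\<close>, so \<open>k\<close> has to exceed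
  \<open>24 * \<omega>\<close> times the logarithm of the target; 28 bounds the logarithm of
  \<open>2 ^ 28\<close>.\<close>

lemma bdgm_terminates: "bdgm_terminates f Hz \<delta> L3 \<xi> z"
  and bdgm_count_le: "real (bdgm_count f Hz \<delta> L3 \<xi> z) \<le> \<omega>\<^sup>2 * (745 + 72 * ln X)"
proof -
  define k where "k = nat \<lceil>24 * \<omega> * (28 + 3 * ln (\<omega> * X))\<rceil>"
  have wX: "1 \<le> \<omega> * X"
    using mult_mono[OF omega_ge_1 X_ge_1] omega_ge_1 by simp
  have k: "24 * \<omega> * (28 + 3 * ln (\<omega> * X)) \<le> real k"
    unfolding k_def by linarith
  have "(1 - 1 / (24 * \<omega>)) ^ k \<le> exp (- 1 / (24 * \<omega>)) ^ k"
    using exp_ge_add_one_self[of "- 1 / (24 * \<omega>)"] omega_ge_1 xi_gt_1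
    by (intro power_mono) (auto simp: field_simps)
  also have "\<dots> = exp (- (real k / (24 * \<omega>)))"
    by (simp only: exp_of_nat_mult[symmetric] times_divide_eq_right mult_minus_right mult_1_right
        minus_divide_left)
  also have "\<dots> \<le> exp (- (28 + 3 * ln (\<omega> * X)))"
  proof -
    have "28 + 3 * ln (\<omega> * X) \<le> real k / (24 * \<omega>)"
      using k by (subst pos_le_divide_eq) (use omega_ge_1 in linarith, metis mult.commute)
    then show ?thesis
      by simp
  qed
  also have "\<dots> \<le> 1 / (2 ^ 28 * (\<omega> * X) ^ 3)"
  proof -
    have "(2::real) ^ 28 \<le> exp 1 ^ 28"
      using exp_ge_add_one_self[of 1] by (intro power_mono) auto
    also have "\<dots> = exp 28"
      by (simp add: exp_of_nat_mult[symmetric])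
    finally have "2 ^ 28 * (\<omega> * X) ^ 3 \<le> exp 28 * exp (ln (\<omega> * X)) ^ 3"
      using wX by (intro mult_mono) auto
    also have "\<dots> = exp (28 + 3 * ln (\<omega> * X))"
      by (simp add: exp_of_nat_mult[symmetric] exp_add)
    finally have "2 ^ 28 * (\<omega> * X) ^ 3 \<le> exp (28 + 3 * ln (\<omega> * X))" .
    moreover have "exp (- u) \<le> 1 / v" if "v \<le> exp u" "0 < v" for u v :: real
      using that by (simp add: exp_minus field_simps)
    moreover have "0 < 2 ^ 28 * (\<omega> * X) ^ 3"
      by (rule mult_pos_pos[OF _ zero_less_power[OF less_le_trans[OF zero_less_one wX]]]) simp
    ultimately show ?thesis
      by blast
  qed
  finally have "(1 - 1 / (24 * \<omega>)) ^ k * (2 ^ 28 * (\<omega> * X) ^ 3) \<le> 1"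
    using wX by (simp add: pos_le_divide_eq)
  then obtain j where j: "j \<le> k" "bdgm_stop f Hz \<delta> L3 \<xi> z j"
    using bdgm_stop_if by blast
  then show "bdgm_terminates f Hz \<delta> L3 \<xi> z"
    by (auto simp: bdgm_terminates_def)
  have "real (bdgm_count f Hz \<delta> L3 \<xi> z) \<le> real k"
    using j unfolding bdgm_count_def by (meson Least_le le_trans of_nat_mono)
  also have "\<dots> \<le> 1 + 24 * \<omega> * (28 + 3 * ln (\<omega> * X))"
  proof -
    have "0 \<le> 24 * \<omega> * (28 + 3 * ln (\<omega> * X))"
      using wX omega_ge_1 by (intro mult_nonneg_nonneg add_nonneg_nonneg) auto
    then show ?thesis
      unfolding k_def by linarith
  qed
  also have "\<dots> \<le> 1 + 24 * \<omega> * (28 + 3 * \<omega> + 3 * ln X)"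
  proof -
    have "ln (\<omega> * X) = ln \<omega> + ln X"
      using ln_mult_pos[of \<omega> X] omega_ge_1 X_ge_1 by (meson less_le_trans zero_less_one)
    moreover have "ln \<omega> \<le> \<omega>"
      using ln_le_minus_one[of \<omega>] omega_ge_1 by linarith
    ultimately show ?thesis
      using omega_ge_1 by (intro add_left_mono mult_left_mono) linarith+
  qed
  \<comment> \<open>745 is \<open>1 + 24 * 28 + 72\<close>, with every power of
    \<open>\<omega>\<close> raised to the square.\<close>
  also have "\<dots> \<le> \<omega>\<^sup>2 * (745 + 72 * ln X)"
  proof -
    have w2: "1 \<le> \<omega>\<^sup>2" "\<omega> \<le> \<omega>\<^sup>2"
      using omega_ge_1 self_le_power[of \<omega> 2] by (auto intro: one_le_power)
    moreover have "\<omega> * ln X \<le> \<omega>\<^sup>2 * ln X"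
      using w2 X_ge_1 by (intro mult_right_mono) auto
    moreover have "1 + 24 * \<omega> * (28 + 3 * \<omega> + 3 * ln X)
        = 1 + 672 * \<omega> + 72 * \<omega>\<^sup>2 + 72 * (\<omega> * ln X)"
      by (simp add: algebra_simps power2_eq_square)
    ultimately show ?thesis
      unfolding distrib_left[of "\<omega>\<^sup>2"] by linarith
  qed
  finally show "real (bdgm_count f Hz \<delta> L3 \<xi> z) \<le> \<omega>\<^sup>2 * (745 + 72 * ln X)" .
qed

lemma bdgm_result:
  obtains yt where "bdgm f Hz \<delta> L3 \<xi> z = (yt, lam yt)" "ms_condition f (lam yt) z yt"
proof -
  have "bdgm_stop f Hz \<delta> L3 \<xi> z (bdgm_count f Hz \<delta> L3 \<xi> z)"
    using bdgm_terminates unfolding bdgm_terminates_def bdgm_count_def by (rule LeastI_ex)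
  then show thesis
    by (intro that[of "it (bdgm_count f Hz \<delta> L3 \<xi> z)"]) (simp_all add: bdgm_def bdgm_stop_def Let_def)
qed

end

section \<open>The potential of the outer loop\<close>

text \<open>Tangent inequalities at \<open>y\<close> towards \<open>x\<close> and \<open>p\<close>,
  weighted by \<open>A\<close> and \<open>a'\<close>, lose their dependence on \<open>x\<close>,
  \<open>v\<close> and \<open>p\<close> by the choice of \<open>z\<close>; only
  \<open>(A + a') * (grad f y \<bullet> (y - z))\<close> remains. The stopping condition makes this
  so negative that it also pays for the squared gradient from the update of
  \<open>v\<close>.\<close>

lemma (in smooth_convex) ms_descent:
  fixes x v y p :: 'a
  assumes A: "0 \<le> A" and lam': "0 < lam'" and lam: "0 < lam"
    and a': "a' = (1 + sqrt (1 + 4 * lam' * A)) / (2 * lam')"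
    and z: "z = (1 / (A + a')) *\<^sub>R (A *\<^sub>R x + a' *\<^sub>R v)"
    and ms: "ms_condition f lam z y"
    and b: "b = min 1 (lam' / lam)"
    and xnew: "f xnew \<le> f ((1 / (A + b * a')) *\<^sub>R (((1 - b) * A) *\<^sub>R x + (b * (A + a')) *\<^sub>R y))"
  shows "(A + b * a') * (f xnew - f p) + (norm (v - (b * a') *\<^sub>R grad f y - p))\<^sup>2 / 2
      + 3 / 8 * (b * (A + a') * lam * (norm (y - z))\<^sup>2)
    \<le> A * (f x - f p) + (norm (v - p))\<^sup>2 / 2"
proof -
  let ?g = "grad f y"
  have sq: "0 \<le> sqrt (1 + 4 * lam' * A)" "(sqrt (1 + 4 * lam' * A))\<^sup>2 = 1 + 4 * lam' * A"
    using A lam' by simp_all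
  then have a'_pos: "0 < a'"
    using A lam' unfolding a' by (intro divide_pos_pos add_pos_nonneg) auto
  have quad: "lam' * a'\<^sup>2 = A + a'"
    using lam' sq(2) unfolding a' by (simp add: field_simps power2_eq_square)
  have b01: "0 < b" "b \<le> 1" "b * lam \<le> lam'"
    using lam lam' by (auto simp: b min_def field_simps)
  have A_new: "0 < A + b * a'"
    using A a'_pos b01 by (simp add: add_nonneg_pos)
  have conv: "(A + b * a') * f xnew \<le> (1 - b) * A * f x + b * (A + a') * f y"
  proof -
    \<comment> \<open>The trial point is the convex combination of \<open>x\<close> and
      \<open>y\<close> with weight \<open>?s\<close> on \<open>y\<close>.\<close>
    let ?s = "b * (A + a') / (A + b * a')"
    have s: "0 \<le> ?s" "?s \<le> 1"
      using A a'_pos b01 A_new mult_left_le_one_le[of A b] by (auto simp: field_simps)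
    have s': "1 - ?s = (1 - b) * A / (A + b * a')"
      using A_new by (simp add: field_simps)
    have "f xnew \<le> f ((1 - ?s) *\<^sub>R x + ?s *\<^sub>R y)"
      using xnew unfolding s' by (simp add: scaleR_add_right)
    also have "\<dots> \<le> (1 - ?s) * f x + ?s * f y"
      using convex_onD[OF convex s] by simp
    also have "\<dots> = ((1 - b) * A * f x + b * (A + a') * f y) / (A + b * a')"
      unfolding s' by (simp add: add_divide_distrib)
    finally show ?thesis
      using A_new by (simp add: pos_le_divide_eq mult.commute)
  qed
  have "b * (A * (f y - f x) + a' * (f y - f p)) \<le> b * (A * (?g \<bullet> (y - x)) + a' * (?g \<bullet> (y - p)))"
    using grad_inequality[of y x] grad_inequality[of y p] A a'_pos b01
    by (intro mult_left_mono add_mono) (auto simp: inner_diff_right)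
  then have lin: "(A + b * a') * (f xnew - f p) - A * (f x - f p)
      \<le> b * (A * (?g \<bullet> (y - x)) + a' * (?g \<bullet> (y - p)))"
    using conv by (simp add: algebra_simps)
  have vterm: "(norm (v - (b * a') *\<^sub>R ?g - p))\<^sup>2 / 2
      = (norm (v - p))\<^sup>2 / 2 - b * (a' * (?g \<bullet> (v - p))) + b\<^sup>2 * a'\<^sup>2 * (norm ?g)\<^sup>2 / 2"
    unfolding power2_norm_eq_inner
    by (simp add: inner_commute algebra_simps power2_eq_square add_divide_distrib diff_divide_distrib)
  have "(A + a') *\<^sub>R z = A *\<^sub>R x + a' *\<^sub>R v"
    using A a'_pos unfolding z by simp
  then have "(A + a') * (?g \<bullet> z) = A * (?g \<bullet> x) + a' * (?g \<bullet> v)"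
    by (metis inner_add_right inner_scaleR_right)
  then have zterm: "A * (?g \<bullet> (y - x)) + a' * (?g \<bullet> (y - p)) - a' * (?g \<bullet> (v - p))
      = (A + a') * (?g \<bullet> (y - z))"
    by (simp add: inner_diff_right algebra_simps)
  \<comment> \<open>Squaring and expanding leaves the coefficient \<open>3 / 4\<close>, which is 1
    minus the square of \<open>1 / 2\<close>; it becomes \<open>3 / 8\<close> after halving.\<close>
  have "(norm (?g + lam *\<^sub>R (y - z)))\<^sup>2 \<le> (lam / 2 * norm (y - z))\<^sup>2"
    using ms unfolding ms_condition_def by (intro power_mono) auto
  also have "(norm (?g + lam *\<^sub>R (y - z)))\<^sup>2
      = (norm ?g)\<^sup>2 + 2 * lam * (?g \<bullet> (y - z)) + lam\<^sup>2 * (norm (y - z))\<^sup>2"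
    unfolding power2_norm_eq_inner
    by (simp add: inner_add_left inner_add_right inner_commute power2_eq_square)
  finally have "2 * lam * (?g \<bullet> (y - z)) \<le> - (norm ?g)\<^sup>2 - 3 / 4 * lam\<^sup>2 * (norm (y - z))\<^sup>2"
    by (simp add: power_mult_distrib power_divide)
  moreover have "lam * (w * P) \<le> - (w * N / 2) - lam * (3 / 8 * (w * lam * D))"
    if "2 * lam * P \<le> - N - 3 / 4 * lam\<^sup>2 * D" "0 \<le> w" for P N D w :: real
    using mult_left_mono[OF that(1), of "w / 2"] that(2)
    by (simp add: algebra_simps power2_eq_square)
  moreover have "0 \<le> b * (A + a')"
    using A a'_pos b01 by simp
  ultimately have "lam * (b * (A + a') * (?g \<bullet> (y - z)))
      \<le> - (b * (A + a') * (norm ?g)\<^sup>2 / 2) - lam * (3 / 8 * (b * (A + a') * lam * (norm (y - z))\<^sup>2))"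
    by blast
  \<comment> \<open>The damping \<open>b\<close> serves here: \<open>b * lam\<close> is at most
    \<open>lam'\<close>, and \<open>lam' * a'\<^sup>2\<close> equals \<open>A + a'\<close>.\<close>
  moreover have "lam * (b\<^sup>2 * a'\<^sup>2 * (norm ?g)\<^sup>2 / 2) \<le> b * (A + a') * (norm ?g)\<^sup>2 / 2"
  proof -
    have "b * lam * (b * a'\<^sup>2 * (norm ?g)\<^sup>2 / 2) \<le> lam' * (b * a'\<^sup>2 * (norm ?g)\<^sup>2 / 2)"
      using b01 by (intro mult_right_mono) auto
    then show ?thesis
      unfolding quad[symmetric] by (simp add: power2_eq_square mult_ac)
  qed
  ultimately have "lam * (b * (A + a') * (?g \<bullet> (y - z)) + b\<^sup>2 * a'\<^sup>2 * (norm ?g)\<^sup>2 / 2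
      + 3 / 8 * (b * (A + a') * lam * (norm (y - z))\<^sup>2)) \<le> 0"
    unfolding distrib_left[of lam] by linarith
  then have "b * (A + a') * (?g \<bullet> (y - z)) + b\<^sup>2 * a'\<^sup>2 * (norm ?g)\<^sup>2 / 2
      + 3 / 8 * (b * (A + a') * lam * (norm (y - z))\<^sup>2) \<le> 0"
    using lam by (simp add: mult_le_0_iff)
  moreover have "b * (A * (?g \<bullet> (y - x)) + a' * (?g \<bullet> (y - p))) - b * (a' * (?g \<bullet> (v - p)))
      = b * (A + a') * (?g \<bullet> (y - z))"
    using zterm by (metis mult.assoc right_diff_distrib)
  ultimately show ?thesis
    using lin vterm by linarith
qed

section \<open>Invariants of the accelerated iteration\<close>

locale aine_problem = smooth_convex f L3 for f :: "'a::euclidean_space \<Rightarrow> real" and L3 +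
  fixes H :: "'a \<Rightarrow> 'a \<Rightarrow>\<^sub>L 'a" and x0 xs :: 'a and \<delta> \<xi> c1 c2 D0 :: real and \<kappa> :: "nat \<Rightarrow> real"
  assumes minimizer: "\<And>y. f xs \<le> f y"
    and delta_pos: "0 < \<delta>"
    and estimator: "hessian_estimator f \<delta> H"
    and xi_gt_1: "1 < \<xi>"
    and c1_pos: "0 < c1"
    and kappa: "\<And>t. c1 \<le> \<kappa> t \<and> \<kappa> t \<le> c2"
    and D0_eq: "D0 = 1 / 2 * (norm (x0 - xs))\<^sup>2"
begin

abbreviation "S \<equiv> aine f H \<delta> L3 \<xi> D0 \<kappa> x0"
abbreviation "A t \<equiv> st_A (S t)"
abbreviation "g t \<equiv> aine_guess \<delta> L3 D0 \<kappa> t (S t)"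
abbreviation "a' t \<equiv> aine_a' \<delta> L3 D0 \<kappa> t (S t)"
abbreviation "q t \<equiv> aine_query \<delta> L3 D0 \<kappa> t (S t)"
abbreviation "ans t \<equiv> bdgm f (H (q t)) \<delta> L3 \<xi> (q t)"
abbreviation "b t \<equiv> min 1 (g t / snd (ans t))"
abbreviation "lam \<equiv> bdgm_lambda \<delta> L3 \<xi>"

definition potential :: "nat \<Rightarrow> real" where
  "potential t = A t * (f (st_x (S t)) - f xs) + (norm (st_v (S t) - xs))\<^sup>2 / 2"

lemma bdgm_problem: "bdgm_problem f L3 \<delta> \<xi> z (H z)"
  using estimator delta_pos xi_gt_1
  by unfold_locales (auto simp: hessian_estimator_def)

lemma D0_nonneg: "0 \<le> D0"
  by (simp add: D0_eq)

lemma lam_pos: "0 < lam z y"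
  using delta_pos xi_gt_1 L3_pos
  by (auto simp: bdgm_lambda_def intro!: add_pos_nonneg)

lemma bdgm_answer:
  obtains y where "bdgm f (H z) \<delta> L3 \<xi> z = (y, lam z y)" "ms_condition f (lam z y) z y"
  using bdgm_problem.bdgm_result[OF bdgm_problem] by blast

text \<open>An admissible guess for the weight \<open>B\<close>. The factor is existential because a
  stored guess no longer shows which \<open>\<kappa> t\<close> produced it.\<close>

definition guess_ok :: "real \<Rightarrow> real \<Rightarrow> bool" where
  "guess_ok B u \<longleftrightarrow> (\<exists>k. c1 \<le> k \<and> k \<le> c2 \<and> u = k * (\<delta> + (D0 * L3 / B powr (3 / 2)) powr (2 / 5)))"

lemma guess_ok_pos: "guess_ok B u \<Longrightarrow> 0 < u"
  using c1_pos delta_pos by (auto simp: guess_ok_def intro!: mult_pos_pos add_pos_nonneg)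

text \<open>Iteration 1 is the first to store a weight and a guess from the prescribed formula, so
  these are constrained only from \<open>t = 2\<close> on. The initial state is recorded exactly
  because its weight is zero and its guess comes from the subroutine.\<close>

definition invariant :: "nat \<Rightarrow> bool" where
  "invariant t \<longleftrightarrow> finite (st_seen (S t)) \<and> st_x (S t) \<in> st_seen (S t) \<and> f (st_x (S t)) \<le> f x0
    \<and> (if t = 0 then S t = aine_init f H \<delta> L3 \<xi> x0 else 0 < A t)
    \<and> (1 < t \<longrightarrow> guess_ok (st_As (S t)) (st_guess (S t)) \<and> 0 < st_As (S t) \<and> st_As (S t) \<le> A t)
    \<and> potential t \<le> D0"

text \<open>\<open>B\<close> is the weight from which the current guess was computed. The doubling
  test keeps it within a factor 2 of the current weight.\<close>

lemma guess_cases: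
  assumes "invariant t" "0 < t"
  obtains B where "guess_ok B (g t)" "0 < B" "B \<le> A t" "A t \<le> 2 * B"
    "B = (if aine_refresh t (S t) then A t else st_As (S t))"
proof (cases "aine_refresh t (S t)")
  case True
  then have "guess_ok (A t) (g t)"
    using assms kappa by (auto simp: aine_guess_def guess_ok_def)
  with assms True that[of "A t"] show thesis
    by (simp add: invariant_def)
next
  case False
  with assms that[of "st_As (S t)"] show thesis
    by (auto simp: aine_guess_def invariant_def aine_refresh_def)
qed

lemma A_nonneg: "invariant t \<Longrightarrow> 0 \<le> A t"
  by (cases "t = 0") (auto simp: invariant_def aine_init_def)

lemma guess_pos:
  assumes "invariant t"
  shows "0 < g t"
proof (cases "t = 0")
  case True
  obtain y where "bdgm f (H x0) \<delta> L3 \<xi> x0 = (y, lam x0 y)"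
    using bdgm_answer by blast
  with True lam_pos show ?thesis
    by (simp add: aine_guess_def aine_init_def)
next
  case False
  with guess_cases[OF assms] guess_ok_pos show ?thesis
    by (metis gr0I)
qed

lemma a'_eq: "a' t = (1 + sqrt (1 + 4 * g t * A t)) / (2 * g t)"
  by (simp add: aine_a'_def Let_def)

lemma a'_pos:
  assumes "invariant t"
  shows "0 < a' t"
  unfolding a'_eq using guess_pos[OF assms] A_nonneg[OF assms]
  by (intro divide_pos_pos add_pos_nonneg) auto

lemma a'_quadratic:
  assumes "invariant t"
  shows "g t * (a' t)\<^sup>2 = A t + a' t"
proof -
  have "(sqrt (1 + 4 * g t * A t))\<^sup>2 = 1 + 4 * g t * A t"
    using guess_pos[OF assms] A_nonneg[OF assms] by simp
  then show ?thesis
    using guess_pos[OF assms] unfolding a'_eq by (simp add: field_simps power2_eq_square)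
qed

lemma query_eq: "q t = (1 / (A t + a' t)) *\<^sub>R (A t *\<^sub>R st_x (S t) + a' t *\<^sub>R st_v (S t))"
  by (simp add: aine_query_def Let_def)

lemma potential_0: "potential 0 = D0"
  unfolding potential_def by (simp add: aine_init_def) (simp add: D0_eq)

lemma invariant_0: "invariant 0"
  by (simp add: invariant_def aine_init_def potential_0)

lemma query_0: "q 0 = x0"
  using a'_pos[OF invariant_0] unfolding query_eq by (simp add: aine_init_def)

text \<open>The answer stored initially was computed at \<open>x0\<close>, which is the query point
  of iteration 0 because \<open>A 0\<close> vanishes. Hence iteration 0 can be treated like all
  others.\<close>

lemma step_answer: "(if 0 < t then ans t else st_answer (S t)) = ans t"
proof (cases "t = 0")
  case True
  then show ?thesis
    using query_0 by (simp add: aine_init_def)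
qed simp

lemma st_A_Suc: "A (Suc t) = A t + b t * a' t"
  using step_answer[of t]
  by (simp add: aine_step_def Let_def split: prod.split)

lemma st_v_Suc: "st_v (S (Suc t)) = st_v (S t) - (b t * a' t) *\<^sub>R grad f (fst (ans t))"
  using step_answer[of t]
  by (simp add: aine_step_def Let_def split: prod.split)

lemma st_x_Suc:
  "st_x (S (Suc t)) = arg_min_on f (insert ((1 / (A t + b t * a' t)) *\<^sub>R
     (((1 - b t) * A t) *\<^sub>R st_x (S t) + (b t * (A t + a' t)) *\<^sub>R fst (ans t))) (st_seen (S t)))"
  using step_answer[of t]
  by (simp add: aine_step_def Let_def split: prod.split)

lemma st_seen_Suc: "st_seen (S (Suc t)) = insert (st_x (S (Suc t))) (st_seen (S t))"
  by (simp add: aine_step_def Let_def split: prod.split)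

lemma st_As_Suc: "st_As (S (Suc t)) = (if aine_refresh t (S t) then A t else st_As (S t))"
  by (simp add: aine_step_def Let_def split: prod.split)

lemma st_guess_Suc: "st_guess (S (Suc t)) = g t"
  by (simp add: aine_step_def Let_def split: prod.split)

lemma st_calls_step: "st_calls (S (Suc t)) = st_calls (S t) + (if 0 < t then 1 else 0)"
  by (simp add: aine_step_def Let_def split: prod.split)

text \<open>Initialization makes one call and iteration 0 none, so any positive number of iterations
  costs exactly that many calls.\<close>

lemma st_calls_Suc: "st_calls (S (Suc t)) = Suc t"
proof (induction t)
  case 0
  show ?case
    unfolding st_calls_step by (simp add: aine_init_def)
next
  case (Suc t)
  show ?case
    unfolding st_calls_step[of "Suc t"] Suc by simp
qed

declare aine.simps [simp del]

text \<open>\<open>ms_descent\<close> with \<open>p\<close> the minimizer. Choosing the best point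
  seen makes the new value at most that of the trial point, as required there, and at most the old
  value.\<close>

lemma step:
  assumes inv: "invariant t"
  shows step_invariant: "invariant (Suc t)"
    and step_potential: "potential (Suc t)
      + 3 / 8 * (b t * (A t + a' t) * snd (ans t) * (norm (fst (ans t) - q t))\<^sup>2) \<le> potential t"
proof -
  obtain y where y: "ans t = (y, lam (q t) y)" "ms_condition f (lam (q t) y) (q t) y"
    using bdgm_answer by blast
  let ?xhat = "(1 / (A t + b t * a' t)) *\<^sub>R
    (((1 - b t) * A t) *\<^sub>R st_x (S t) + (b t * (A t + a' t)) *\<^sub>R y)"
  let ?x = "st_x (S (Suc t))" and ?M = "insert ?xhat (st_seen (S t))"
  have x_eq: "?x = arg_min_on f ?M"
    using st_x_Suc[of t] y(1) by simp
  have fin: "finite ?M" "?M \<noteq> {}"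
    using inv by (auto simp: invariant_def)
  have x_le: "f ?x \<le> f w" if "w \<in> ?M" for w
    using arg_min_if_finite(2)[OF fin, of f] that unfolding x_eq by (meson not_le)
  have b: "0 < b t"
    using divide_pos_pos[OF guess_pos[OF inv] lam_pos[of "q t" y]] y(1) by simp
  have "(A t + b t * a' t) * (f ?x - f xs)
      + (norm (st_v (S t) - (b t * a' t) *\<^sub>R grad f y - xs))\<^sup>2 / 2
      + 3 / 8 * (b t * (A t + a' t) * lam (q t) y * (norm (y - q t))\<^sup>2)
    \<le> A t * (f (st_x (S t)) - f xs) + (norm (st_v (S t) - xs))\<^sup>2 / 2"
    using y by (intro ms_descent[where lam' = "g t"] A_nonneg guess_pos inv a'_eq query_eq lam_pos x_le)
      auto
  then show pot: "potential (Suc t)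
      + 3 / 8 * (b t * (A t + a' t) * snd (ans t) * (norm (fst (ans t) - q t))\<^sup>2) \<le> potential t"
    unfolding potential_def st_A_Suc st_v_Suc using y(1) by simp
  have "0 \<le> 3 / 8 * (b t * (A t + a' t) * snd (ans t) * (norm (fst (ans t) - q t))\<^sup>2)"
    using b A_nonneg[OF inv] a'_pos[OF inv] lam_pos[of "q t" y] y(1) by simp
  then have pot': "potential (Suc t) \<le> D0"
    using pot inv unfolding invariant_def by linarith
  have A_gt: "A t < A (Suc t)"
    using b a'_pos[OF inv] unfolding st_A_Suc by simp
  have "1 < Suc t \<longrightarrow> guess_ok (st_As (S (Suc t))) (st_guess (S (Suc t)))
    \<and> 0 < st_As (S (Suc t)) \<and> st_As (S (Suc t)) \<le> A (Suc t)"
    unfolding st_As_Suc st_guess_Suc using guess_cases[OF inv] A_gt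
    by (smt (verit) less_Suc_eq_0_disj less_one not_less_eq)
  then show "invariant (Suc t)"
    using inv A_gt A_nonneg[OF inv] x_le[of "st_x (S t)"] pot'
    unfolding invariant_def st_seen_Suc by auto
qed

lemma invariant: "invariant t"
  by (induction t) (simp_all add: invariant_0 step_invariant)

lemmas A_ge_0 = A_nonneg[OF invariant]
lemmas g_pos = guess_pos[OF invariant]
lemmas a'_gt_0 = a'_pos[OF invariant]

lemma A_pos: "0 < t \<Longrightarrow> 0 < A t"
  using invariant[of t] by (simp add: invariant_def)

lemma b_bounds: "0 < b t" "b t \<le> 1"
proof -
  obtain y where "ans t = (y, lam (q t) y)"
    using bdgm_answer by blast
  then show "0 < b t" "b t \<le> 1"
    using divide_pos_pos[OF g_pos[of t] lam_pos[of "q t" y]] by simp_all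
qed

lemma A_mono: "A t \<le> A (Suc t)"
  using b_bounds[of t] a'_gt_0[of t] unfolding st_A_Suc by simp

lemma potential_mono: "potential (Suc t) \<le> potential t"
proof -
  obtain y where y: "ans t = (y, lam (q t) y)"
    using bdgm_answer by blast
  have "0 \<le> 3 / 8 * (b t * (A t + a' t) * snd (ans t) * (norm (fst (ans t) - q t))\<^sup>2)"
    using b_bounds[of t] A_ge_0[of t] a'_gt_0[of t] lam_pos[of "q t" y] y by simp
  with step_potential[OF invariant, of t] show ?thesis
    by linarith
qed

lemma potential_nonneg: "0 \<le> potential t"
  unfolding potential_def using A_ge_0 minimizer by simp

lemma value_bound:
  assumes "0 < t"
  shows "f (st_x (S t)) - f xs \<le> D0 / A t"
proof -
  have "A t * (f (st_x (S t)) - f xs) \<le> D0"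
    using invariant[of t] zero_le_power2[of "norm (st_v (S t) - xs)"]
    unfolding invariant_def potential_def by linarith
  then show ?thesis
    using A_pos[OF assms] by (simp add: pos_le_divide_eq mult.commute)
qed

text \<open>The potential bounds the distance of \<open>v\<close> from \<open>xs\<close> by that of
  \<open>x0\<close>, and the query is a convex combination of \<open>x\<close> and
  \<open>v\<close>.\<close>

lemma query_close:
  assumes "norm (x0 - xs) \<le> R" "norm (st_x (S t) - xs) \<le> R"
  shows "norm (q t - xs) \<le> R"
proof -
  have "(norm (st_v (S t) - xs))\<^sup>2 \<le> (norm (x0 - xs))\<^sup>2"
  proof -
    have "0 \<le> A t * (f (st_x (S t)) - f xs)"
      using A_ge_0 minimizer by simp
    moreover have "potential t \<le> D0"
      using invariant[of t] by (simp add: invariant_def)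
    ultimately show ?thesis
      using D0_eq unfolding potential_def by linarith
  qed
  then have v: "st_v (S t) \<in> cball xs R"
    using assms(1) power2_le_imp_le[of "norm (st_v (S t) - xs)" "norm (x0 - xs)"]
    by (simp add: dist_norm norm_minus_commute)
  have x: "st_x (S t) \<in> cball xs R"
    using assms(2) by (simp add: dist_norm norm_minus_commute)
  have "A t / (A t + a' t) + a' t / (A t + a' t) = 1"
    using A_ge_0[of t] a'_gt_0[of t] by (simp add: add_divide_distrib[symmetric])
  from convexD[OF convex_cball x v _ _ this] have "q t \<in> cball xs R"
    unfolding query_eq using A_ge_0[of t] a'_gt_0[of t] by (simp add: scaleR_add_right)
  then show ?thesis
    by (simp add: dist_norm norm_minus_commute)
qed

text \<open>In iteration 0 the guess is the returned value itself, so there is no damping and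
  \<open>A 1\<close> is its reciprocal. The drop of the potential bounds the length of the step,
  hence that value.\<close>

lemma initial_growth: "1 / A 1 \<le> \<xi>\<^sup>2 * (\<delta> + L3 * D0)"
proof -
  obtain y where y: "bdgm f (H x0) \<delta> L3 \<xi> x0 = (y, lam x0 y)"
    using bdgm_answer by blast
  let ?l = "lam x0 y"
  have l: "0 < ?l"
    by (rule lam_pos)
  have ans: "ans 0 = (y, ?l)"
    unfolding query_0 by (rule y)
  have g: "g 0 = ?l"
    using y by (simp add: aine_guess_def aine.simps(1) aine_init_def)
  have b: "b 0 = 1"
    using g ans l by simp
  have A0: "A 0 = 0"
    by (simp add: aine.simps(1) aine_init_def)
  have a': "a' 0 = 1 / ?l"
    unfolding a'_eq A0 g by simp
  have "0 + 3 / 8 * (norm (y - x0))\<^sup>2 \<le> D0"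
    using step_potential[OF invariant, of 0] potential_nonneg[of "Suc 0"] l
    unfolding query_0 y A0 a' g potential_0 by simp
  then have r: "(norm (y - x0))\<^sup>2 \<le> 8 / 3 * D0"
    by simp
  have "1 / A 1 = ?l"
    using st_A_Suc[of 0] unfolding b A0 a' by simp
  also have "\<dots> = (\<xi>\<^sup>2 - 1) / \<xi> * \<delta> + (1 + \<xi>) * \<xi> / 6 * L3 * (norm (y - x0))\<^sup>2"
    by (simp add: bdgm_lambda_def)
  \<comment> \<open>The factor \<open>3 / 8\<close> is inserted to cancel the \<open>8 / 3\<close>
    from the bound on the step.\<close>
  also have "\<dots> \<le> \<xi>\<^sup>2 * \<delta> + \<xi>\<^sup>2 * 3 / 8 * L3 * (8 / 3 * D0)"
  proof (intro add_mono mult_right_mono mult_mono r)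
    have "\<xi>\<^sup>2 * 1 \<le> \<xi>\<^sup>2 * \<xi>"
      using xi_gt_1 by (intro mult_left_mono) auto
    then have "\<xi>\<^sup>2 - 1 \<le> \<xi>\<^sup>2 * \<xi>"
      by linarith
    then show "(\<xi>\<^sup>2 - 1) / \<xi> \<le> \<xi>\<^sup>2"
      using xi_gt_1 by (simp add: pos_divide_le_eq)
    have "\<xi> \<le> \<xi>\<^sup>2" "0 \<le> \<xi>\<^sup>2"
      using xi_gt_1 by (simp_all add: power2_eq_square)
    moreover have "(1 + \<xi>) * \<xi> = \<xi> + \<xi>\<^sup>2"
      by (simp add: distrib_right power2_eq_square)
    ultimately show "(1 + \<xi>) * \<xi> / 6 \<le> \<xi>\<^sup>2 * 3 / 8"
      by linarith
  qed (use xi_gt_1 delta_pos L3_pos in auto)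
  also have "\<dots> = \<xi>\<^sup>2 * (\<delta> + L3 * D0)"
    by (simp add: algebra_simps)
  finally show ?thesis .
qed

end

section \<open>Two facts about powers and logarithms\<close>

lemma powr_two_fifths_power5:
  fixes u B :: real
  assumes "0 < u" "0 < B"
  shows "((u / B powr (3 / 2)) powr (2 / 5)) ^ 5 = u\<^sup>2 / B ^ 3"
proof -
  let ?x = "u / B powr (3 / 2)"
  have "(?x powr (2 / 5)) ^ 5 = (?x powr (2 / 5)) powr 5"
    using assms by simp
  also have "\<dots> = ?x powr 2"
    by (simp only: powr_powr) simp
  also have "\<dots> = u\<^sup>2 / (B powr (3 / 2)) powr 2"
    using assms by (simp add: power_divide)
  also have "(B powr (3 / 2)) powr 2 = B powr 3"
    by (simp only: powr_powr) simp
  finally show ?thesis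
    using assms by simp
qed

text \<open>From \<open>ln v \<le> v - 1\<close> at \<open>v = w / (1 + w)\<close>. It converts a
  growth factor of the weight into an increment of its logarithm.\<close>

lemma ln_add_one_ge:
  fixes w :: real
  assumes "0 < w"
  shows "1 / (1 + w) \<le> ln (1 + 1 / w)"
proof -
  have "ln (w / (1 + w)) \<le> w / (1 + w) - 1"
    using assms by (intro ln_le_minus_one) simp
  moreover have "ln (w / (1 + w)) = - ln (1 + 1 / w)"
    using assms by (simp add: ln_div field_simps flip: ln_inverse)
  moreover have "w / (1 + w) - 1 = - (1 / (1 + w))"
    using assms by (simp add: field_simps)
  ultimately show ?thesis
    by linarith
qed

section \<open>Complexity\<close>

locale aine_accuracy = aine_problem f L3 H x0 xs \<delta> \<xi> c1 c2 D0 \<kappa>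
  for f :: "'a::euclidean_space \<Rightarrow> real" and L3 H x0 xs \<delta> \<xi> c1 c2 D0 \<kappa> +
  fixes \<epsilon> :: real
  assumes eps_pos: "0 < \<epsilon>" and D0_pos: "0 < D0"
begin

abbreviation "A_max \<equiv> D0 / \<epsilon>"
definition "U = (\<delta> * D0 / \<epsilon>) powr (1 / 2)"
definition "V = (L3 * D0\<^sup>2 / \<epsilon>) powr (1 / 5)"
text \<open>Separates good from bad steps. It is large enough that the \<open>\<delta>\<close> part
  of the returned value is at most half of \<open>G * g t\<close>.\<close>

definition "G = 2 * \<xi> * (1 + 1 / c1)"
text \<open>Bounds the square root of \<open>A t * g t\<close>, and thereby the ratio of
  \<open>A t\<close> to \<open>a' t\<close>.\<close>

definition "W = (1 + c2) * (U + V)"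
definition "\<Delta> = D0 / (\<xi> * V * (1 + 1 / c1))"

lemma UV_pos: "0 < U" "0 < V"
  using delta_pos D0_pos eps_pos L3_pos by (simp_all add: U_def V_def)

lemma U_square: "U\<^sup>2 = \<delta> * A_max"
  using delta_pos D0_pos eps_pos by (simp add: U_def powr_half_sqrt)

lemma V_power5: "V ^ 5 = D0 * L3 * A_max"
proof -
  have "V ^ 5 = V powr 5"
    using UV_pos by simp
  also have "\<dots> = (L3 * D0\<^sup>2 / \<epsilon>) powr 1"
    by (simp only: V_def powr_powr) simp
  also have "\<dots> = D0 * L3 * A_max"
    using D0_pos eps_pos L3_pos by (simp add: power2_eq_square)
  finally show ?thesis .
qed

lemma c2_pos: "0 < c2"
  using kappa[of 0] c1_pos by linarith

lemma G_ge_1: "1 \<le> G"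
proof -
  have "1 * 1 \<le> (2 * \<xi>) * (1 + 1 / c1)"
    using xi_gt_1 c1_pos by (intro mult_mono) auto
  then show ?thesis
    by (simp add: G_def)
qed

lemma W_pos: "0 < W"
  unfolding W_def using c2_pos by (intro mult_pos_pos add_pos_pos UV_pos) auto

lemma GW_pos: "0 < G * W"
  by (rule mult_pos_pos[OF less_le_trans[OF zero_less_one G_ge_1] W_pos])

text \<open>The upper bound uses that the stored weight is at least half of \<open>A t\<close>, the
  lower bound that it is at most \<open>A t\<close> and thus below \<open>A_max\<close>.\<close>

lemma guess_bounds:
  assumes t: "0 < t" "A t < A_max"
  shows guess_upper: "A t * g t \<le> W\<^sup>2"
    and guess_lower: "c1\<^sup>2 * (D0 * L3) \<le> (g t)\<^sup>2 * A t * V"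
    and guess_delta: "c1 * \<delta> \<le> g t"
proof -
  obtain B where B: "guess_ok B (g t)" "0 < B" "B \<le> A t" "A t \<le> 2 * B"
    using guess_cases[OF invariant t(1)] by metis
  define E where "E = D0 * L3"
  define u where "u = (E / B powr (3 / 2)) powr (2 / 5)"
  obtain k where k: "c1 \<le> k" "k \<le> c2" "g t = k * (\<delta> + u)"
    using B(1) by (auto simp: guess_ok_def u_def E_def)
  have E: "0 < E"
    using D0_pos L3_pos by (simp add: E_def)
  have u: "0 < u"
    using E B(2) by (simp add: u_def)
  have u5: "u ^ 5 = E\<^sup>2 / B ^ 3"
    using powr_two_fifths_power5[OF E B(2)] by (simp add: u_def)
  have V5: "V ^ 5 = E * A_max"
    using V_power5 by (simp add: E_def)
  \<comment> \<open>Fifth powers clear the fractional exponents: the left side becomes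
    \<open>(A t)\<^sup>2 * E\<^sup>2\<close> times the cube of \<open>A t / B\<close>, which is at
    most 8.\<close>
  have "A t * u \<le> 2 * V\<^sup>2"
  proof -
    have "(A t * u) ^ 5 = (A t)\<^sup>2 * E\<^sup>2 * (A t ^ 3 / B ^ 3)"
      unfolding power_mult_distrib u5 using power_add[of "A t" 2 3] by simp
    also have "\<dots> \<le> A_max\<^sup>2 * E\<^sup>2 * (2 ^ 3)"
    proof (intro mult_mono)
      show "(A t)\<^sup>2 \<le> A_max\<^sup>2"
        using t A_ge_0 by (intro power_mono) auto
      have "A t ^ 3 \<le> (2 * B) ^ 3"
        using B A_ge_0 by (intro power_mono) auto
      then show "A t ^ 3 / B ^ 3 \<le> 2 ^ 3"
        using B(2) by (simp add: pos_divide_le_eq power_mult_distrib)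
    qed (use A_ge_0 B(2) in auto)
    also have "\<dots> \<le> 32 * (E * A_max)\<^sup>2"
    proof -
      have "A_max\<^sup>2 * E\<^sup>2 * 2 ^ 3 = 8 * (E * A_max)\<^sup>2"
        by (simp add: power_mult_distrib power_divide)
      then show ?thesis
        using zero_le_power2[of "E * A_max"] by linarith
    qed
    also have "\<dots> = (2 * V\<^sup>2) ^ 5"
      unfolding V5[symmetric] by (simp add: power_mult_distrib flip: power_mult)
    finally show ?thesis
      by (rule power_le_imp_le_base[of _ 4, simplified]) simp
  qed
  moreover have "A t * \<delta> \<le> U\<^sup>2"
    unfolding U_square mult.commute[of "A t"] using t delta_pos by (intro mult_left_mono) auto
  ultimately have "A t * (\<delta> + u) \<le> U\<^sup>2 + 2 * V\<^sup>2"
    by (simp add: distrib_left)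
  also have "\<dots> \<le> 2 * (U + V)\<^sup>2"
    using UV_pos by (simp add: power2_sum)
  finally have Au: "A t * (\<delta> + u) \<le> 2 * (U + V)\<^sup>2" .
  have "A t * g t = k * (A t * (\<delta> + u))"
    by (simp add: k(3))
  also have "\<dots> \<le> ((1 + c2)\<^sup>2 / 2) * (2 * (U + V)\<^sup>2)"
  proof (rule mult_mono[OF _ Au])
    have "(1 + c2)\<^sup>2 = 1 + 2 * c2 + c2\<^sup>2"
      by (simp add: power2_sum)
    then show "k \<le> (1 + c2)\<^sup>2 / 2"
      using k(2) zero_le_power2[of c2] by linarith
  qed (use A_ge_0 delta_pos u in auto)
  finally show "A t * g t \<le> W\<^sup>2"
    by (simp add: W_def power_mult_distrib)
  \<comment> \<open>The fifth power of the right side is exactly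
    \<open>E ^ 5 * (A_max / B)\<close>.\<close>
  have "E \<le> u\<^sup>2 * B * V"
  proof -
    have "1 \<le> A_max / B"
      unfolding pos_le_divide_eq[OF B(2)] using B(3) t(2) by linarith
    then have "E ^ 5 * 1 \<le> E ^ 5 * (A_max / B)"
      using E by (intro mult_left_mono) auto
    also have "\<dots> = (u\<^sup>2 * B * V) ^ 5"
    proof -
      have "(u\<^sup>2 * B * V) ^ 5 = (u ^ 5)\<^sup>2 * B ^ 5 * V ^ 5"
        by (simp add: power_mult_distrib flip: power_mult)
      then show ?thesis
        unfolding u5 V5 using B(2) by (simp add: power_numeral_reduce field_simps)
    qed
    finally show ?thesis
      using u B UV_pos by (intro power_le_imp_le_base[of E 4]) auto
  qed
  also have "\<dots> \<le> (\<delta> + u)\<^sup>2 * A t * V"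
    using u B UV_pos delta_pos by (intro mult_right_mono mult_mono power_mono) auto
  finally have "c1\<^sup>2 * E \<le> k\<^sup>2 * ((\<delta> + u)\<^sup>2 * A t * V)"
    using k c1_pos E by (intro mult_mono power_mono) auto
  then show "c1\<^sup>2 * (D0 * L3) \<le> (g t)\<^sup>2 * A t * V"
    by (simp add: k(3) E_def power_mult_distrib mult_ac)
  show "c1 * \<delta> \<le> g t"
    unfolding k(3) using k c1_pos delta_pos u by (intro mult_mono) auto
qed

text \<open>The damping is at least \<open>1 / G\<close> and \<open>a' t\<close> at least
  \<open>A t / W\<close>, so the weight grows by the factor \<open>1 + 1 / (G * W)\<close>.\<close>

lemma good_step:
  assumes t: "0 < t" "A t < A_max" and good: "snd (ans t) \<le> G * g t"
  shows "ln (A t) + 1 / (1 + G * W) \<le> ln (A (Suc t))"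
proof -
  have At: "0 < A t"
    by (rule A_pos[OF t(1)])
  note W = W_pos
  have ans: "0 < snd (ans t)"
    using bdgm_answer[of "q t"] lam_pos by (metis snd_conv)
  have b: "1 / G \<le> b t"
  proof -
    have "1 / G \<le> g t / snd (ans t)"
      using good ans g_pos[of t] G_ge_1 by (simp add: field_simps)
    moreover have "1 / G \<le> 1"
      using G_ge_1 by simp
    ultimately show ?thesis
      by simp
  qed
  have "A t \<le> a' t * W"
  proof (rule power2_le_imp_le)
    have "(A t)\<^sup>2 \<le> A t * (g t * (a' t)\<^sup>2)"
      using a'_quadratic[OF invariant, of t] At a'_gt_0[of t] by (simp add: power2_eq_square)
    also have "\<dots> = A t * g t * (a' t)\<^sup>2"
      by simp
    also have "\<dots> \<le> W\<^sup>2 * (a' t)\<^sup>2"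
      using guess_upper[OF t] by (rule mult_right_mono) simp
    finally show "(A t)\<^sup>2 \<le> (a' t * W)\<^sup>2"
      by (simp add: power_mult_distrib mult.commute)
  qed (use W a'_gt_0[of t] in simp)
  then have "A t / W \<le> a' t"
    using W by (simp add: pos_divide_le_eq)
  then have "A t / W / G \<le> a' t / G"
    using G_ge_1 by (intro divide_right_mono) auto
  then have "A t * (1 / (G * W)) \<le> (1 / G) * a' t"
    by (simp add: mult.commute)
  also have "\<dots> \<le> b t * a' t"
    using b a'_gt_0[of t] by (intro mult_right_mono) auto
  finally have "A t * (1 + 1 / (G * W)) \<le> A (Suc t)"
    unfolding st_A_Suc by (simp add: distrib_left)
  moreover note GW = GW_pos
  ultimately have "ln (A t * (1 + 1 / (G * W))) \<le> ln (A (Suc t))"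
    using At by (intro ln_mono mult_pos_pos add_pos_pos) auto
  moreover have "ln (A t * (1 + 1 / (G * W))) = ln (A t) + ln (1 + 1 / (G * W))"
    using At GW by (intro ln_mult_pos add_pos_pos) auto
  ultimately show ?thesis
    using ln_add_one_ge[OF GW] by linarith
qed

text \<open>A large returned value cannot come from its \<open>\<delta>\<close> part, so the step
  from the query point must be long. The lower bound on the guess turns this into a drop of the
  potential independent of \<open>t\<close>.\<close>

lemma bad_step:
  assumes t: "0 < t" "A t < A_max" and bad: "G * g t < snd (ans t)"
  shows "potential (Suc t) + \<Delta> \<le> potential t"
proof -
  obtain y where y: "ans t = (y, lam (q t) y)"
    using bdgm_answer by blast
  define l r2 where "l = lam (q t) y" and "r2 = (norm (y - q t))\<^sup>2"
  have At: "0 < A t"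
    by (rule A_pos[OF t(1)])
  have l: "0 < l" "G * g t < l"
    using bad y by (simp_all add: l_def lam_pos)
  have "1 * g t \<le> G * g t"
    using G_ge_1 g_pos[of t] by (intro mult_right_mono) auto
  \<comment> \<open>As \<open>G\<close> is at least 1, the minimum is attained by the quotient,
    whence \<open>b t * l\<close> is just \<open>g t\<close>.\<close>
  then have b: "b t = g t / l"
    using l y by (simp add: l_def min_def)
  have "G * g t / 2 \<le> \<xi>\<^sup>2 / 3 * L3 * r2"
  proof -
    have "l = (\<xi>\<^sup>2 - 1) / \<xi> * \<delta> + (1 + \<xi>) * \<xi> / 6 * L3 * r2"
      by (simp add: l_def r2_def bdgm_lambda_def)
    also have "\<dots> \<le> \<xi> * \<delta> + \<xi>\<^sup>2 / 3 * L3 * r2"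
    proof (intro add_mono mult_right_mono)
      show "(\<xi>\<^sup>2 - 1) / \<xi> \<le> \<xi>"
        using xi_gt_1 by (simp add: pos_divide_le_eq power2_eq_square)
      show "(1 + \<xi>) * \<xi> / 6 \<le> \<xi>\<^sup>2 / 3"
        using xi_gt_1 by (simp add: power2_eq_square distrib_right)
    qed (use delta_pos L3_pos in \<open>auto simp: r2_def\<close>)
    also have "\<xi> * \<delta> \<le> G * g t / 2"
    proof -
      have "\<xi> * \<delta> = \<xi> * (1 / c1) * (c1 * \<delta>)"
        using c1_pos by simp
      also have "\<dots> \<le> \<xi> * (1 + 1 / c1) * g t"
        using guess_delta[OF t] xi_gt_1 c1_pos delta_pos by (intro mult_mono) auto
      finally show ?thesis
        by (simp add: G_def)
    qed
    finally show ?thesis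
      using l(2) by linarith
  qed
  moreover have "G * g t / 2 = \<xi> * ((1 + 1 / c1) * g t)"
    by (simp add: G_def)
  ultimately have "\<xi> * ((1 + 1 / c1) * g t) \<le> \<xi> * (1 / 3 * (\<xi> * L3 * r2))"
    by (simp add: power2_eq_square)
  then have "(1 + 1 / c1) * g t \<le> 1 / 3 * (\<xi> * L3 * r2)"
    by (rule mult_left_le_imp_le) (use xi_gt_1 in simp)
  moreover have "0 \<le> \<xi> * L3 * r2"
    using xi_gt_1 L3_pos by (simp add: r2_def)
  ultimately have r2: "(1 + 1 / c1) * g t \<le> 3 / 8 * (\<xi> * L3 * r2)"
    by linarith
  \<comment> \<open>One factor \<open>g t\<close> of the squared lower bound is replaced by the
    bound on the step length. This brings in \<open>L3\<close>, which then cancels.\<close>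
  have "D0 * L3 * 1 \<le> D0 * L3 * (1 + c1)\<^sup>2"
    using D0_pos L3_pos c1_pos by (intro mult_left_mono one_le_power) auto
  also have "\<dots> = (1 + 1 / c1)\<^sup>2 * (c1\<^sup>2 * (D0 * L3))"
    using c1_pos by (simp add: field_simps power2_eq_square)
  also have "\<dots> \<le> (1 + 1 / c1)\<^sup>2 * ((g t)\<^sup>2 * A t * V)"
    using guess_lower[OF t] by (intro mult_left_mono) auto
  also have "\<dots> = ((1 + 1 / c1) * g t) * ((1 + 1 / c1) * g t * A t * V)"
    by (simp add: power2_eq_square)
  also have "\<dots> \<le> (3 / 8 * (\<xi> * L3 * r2)) * ((1 + 1 / c1) * g t * A t * V)"
    using r2 g_pos[of t] At UV_pos c1_pos by (intro mult_right_mono) auto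
  also have "\<dots> = L3 * ((3 / 8 * (g t * A t * r2)) * (\<xi> * V * (1 + 1 / c1)))"
    by (simp only: mult_ac)
  finally have "L3 * D0 \<le> L3 * ((3 / 8 * (g t * A t * r2)) * (\<xi> * V * (1 + 1 / c1)))"
    by (simp add: mult.commute)
  then have "D0 \<le> (3 / 8 * (g t * A t * r2)) * (\<xi> * V * (1 + 1 / c1))"
    using L3_pos by (rule mult_left_le_imp_le)
  then have "\<Delta> \<le> 3 / 8 * (g t * A t * r2)"
    using xi_gt_1 UV_pos c1_pos unfolding \<Delta>_def by (subst pos_divide_le_eq) (auto intro!: mult_pos_pos add_pos_pos)
  also have "\<dots> \<le> 3 / 8 * (g t * (A t + a' t) * r2)"
    using a'_gt_0[of t] g_pos[of t] by (intro mult_left_mono mult_right_mono) (auto simp: r2_def)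
  also have "\<dots> = 3 / 8 * (b t * (A t + a' t) * l * r2)"
    unfolding b using l(1) by simp
  finally show ?thesis
    using step_potential[OF invariant, of t] unfolding y l_def r2_def by simp
qed

text \<open>The logarithm accounts for the good steps, the drop of the potential for the bad ones.\<close>

definition progress :: "nat \<Rightarrow> real" where
  "progress t = (1 + G * W) * ln (A t) - potential t / \<Delta>"

lemma Delta_pos: "0 < \<Delta>"
  using D0_pos xi_gt_1 UV_pos c1_pos by (simp add: \<Delta>_def add_pos_pos)

text \<open>Both summands are scaled so that a step of the matching kind gains one unit, while the
  other summand does not decrease.\<close>

lemma progress_step:
  assumes t: "0 < t" "A t < A_max"
  shows "progress t + 1 \<le> progress (Suc t)"
proof -
  have GW: "0 < 1 + G * W"
    using GW_pos by linarith
  show ?thesis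
  proof (cases "snd (ans t) \<le> G * g t")
    case True
    have "(1 + G * W) * (ln (A t) + 1 / (1 + G * W)) \<le> (1 + G * W) * ln (A (Suc t))"
      using good_step[OF t True] GW by (intro mult_left_mono) auto
    moreover have "(1 + G * W) * (ln (A t) + 1 / (1 + G * W)) = (1 + G * W) * ln (A t) + 1"
      using GW by (simp add: distrib_left)
    moreover have "potential (Suc t) / \<Delta> \<le> potential t / \<Delta>"
      using potential_mono Delta_pos by (intro divide_right_mono) auto
    ultimately show ?thesis
      unfolding progress_def by linarith
  next
    case False
    have "(1 + G * W) * ln (A t) \<le> (1 + G * W) * ln (A (Suc t))"
      using A_mono[of t] A_pos[OF t(1)] GW by (intro mult_left_mono) auto
    moreover have "(potential (Suc t) + \<Delta>) / \<Delta> \<le> potential t / \<Delta>"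
      using bad_step[OF t] False Delta_pos by (intro divide_right_mono) auto
    moreover have "(potential (Suc t) + \<Delta>) / \<Delta> = potential (Suc t) / \<Delta> + 1"
      using Delta_pos by (simp add: add_divide_distrib)
    ultimately show ?thesis
      unfolding progress_def by linarith
  qed
qed

text \<open>Telescoping starts at index 1: \<open>A 0\<close> is zero and its logarithm carries no
  information.\<close>

lemma steps_bound:
  assumes "A (Suc n) < A_max"
  shows "real n \<le> (1 + G * W) * ln (A_max / A 1) + \<xi> * V * (1 + 1 / c1)"
proof -
  have "A (Suc m) < A_max \<Longrightarrow> progress 1 + real m \<le> progress (Suc m)" for m
  proof (induction m)
    case (Suc m)
    with A_mono[of "Suc m"] have "A (Suc m) < A_max"
      by linarith
    with Suc.IH progress_step[of "Suc m"] show ?case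
      by simp
  qed simp
  from this[OF assms] have "real n \<le> progress (Suc n) - progress 1"
    by linarith
  also have "\<dots> \<le> (1 + G * W) * (ln (A (Suc n)) - ln (A 1)) + D0 / \<Delta>"
  proof -
    have "0 \<le> potential (Suc n) / \<Delta>"
      using potential_nonneg Delta_pos by (intro divide_nonneg_pos)
    moreover have "potential 1 / \<Delta> \<le> D0 / \<Delta>"
      using invariant[of 1] Delta_pos by (intro divide_right_mono) (auto simp: invariant_def)
    ultimately show ?thesis
      unfolding progress_def right_diff_distrib[of "1 + G * W"] by linarith
  qed
  also have "D0 / \<Delta> = \<xi> * V * (1 + 1 / c1)"
    using D0_pos by (simp add: \<Delta>_def)
  also have "ln (A (Suc n)) - ln (A 1) \<le> ln (A_max / A 1)"
  proof -
    have "ln (A (Suc n)) \<le> ln A_max"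
      using assms A_pos[of "Suc n"] by (intro ln_mono) auto
    moreover have "ln (A_max / A 1) = ln A_max - ln (A 1)"
      using A_pos[of 1] D0_pos eps_pos by (intro ln_divide_pos) auto
    ultimately show ?thesis
      by linarith
  qed
  finally show ?thesis
    using GW_pos by (simp add: mult_left_mono)
qed

text \<open>If the weight never reached \<open>A_max\<close>, \<open>steps_bound\<close> would bound
  all natural numbers. So a least such index exists, and its predecessor is still subject to the
  bound.\<close>

lemma iterations_bound:
  obtains T where "A_max \<le> A T" "0 < T"
    "real T \<le> 1000 * \<xi> ^ 4 * (1 + 1 / c1)\<^sup>2 * (1 + c2) * iso_bound \<delta> L3 D0 \<epsilon>"
proof -
  let ?P = "\<delta> * D0 / \<epsilon> + L3 * D0\<^sup>2 / \<epsilon>"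
  let ?l = "1 + ln (1 + \<delta> * D0 / \<epsilon> + L3 * D0\<^sup>2 / \<epsilon>)" and ?s = "1 + U + V"
  let ?M = "(1 + G * W) * ln (A_max / A 1) + \<xi> * V * (1 + 1 / c1)"
  define k1 k2 where "k1 = 1 + 1 / c1" and "k2 = 1 + c2"
  have k: "1 \<le> k1" "1 \<le> k2"
    using c1_pos c2_pos by (simp_all add: k1_def k2_def)
  have "0 \<le> ?P"
    using delta_pos D0_pos eps_pos L3_pos by simp
  then have l: "1 \<le> ?l"
    by simp
  have s: "1 \<le> ?s" "V \<le> ?s"
    using UV_pos by simp_all
  have "A_max / A 1 \<le> A_max * (\<xi>\<^sup>2 * (\<delta> + L3 * D0))"
    using mult_left_mono[OF initial_growth, of A_max] D0_pos eps_pos by simp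
  also have "\<dots> = \<xi>\<^sup>2 * ?P"
    by (simp add: algebra_simps add_divide_distrib power2_eq_square)
  also have "\<dots> \<le> \<xi>\<^sup>2 * (1 + ?P)"
    by (intro mult_left_mono) auto
  finally have "ln (A_max / A 1) \<le> ln (\<xi>\<^sup>2 * (1 + ?P))"
    using A_pos[of 1] D0_pos eps_pos by (intro ln_mono) auto
  also have "\<dots> = 2 * ln \<xi> + ln (1 + ?P)"
    using xi_gt_1 \<open>0 \<le> ?P\<close> by (subst ln_mult_pos) (auto simp: ln_realpow)
  also have "\<dots> \<le> 2 * \<xi> + (?l - 1)"
    using ln_le_minus_one[of \<xi>] xi_gt_1 by (simp add: add.assoc)
  also have "\<dots> \<le> 2 * \<xi> * ?l"
  proof -
    have "0 \<le> (2 * \<xi> - 1) * (?l - 1)"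
      using xi_gt_1 l by (intro mult_nonneg_nonneg) auto
    then show ?thesis
      by (simp add: algebra_simps)
  qed
  finally have ln_le: "ln (A_max / A 1) \<le> 2 * \<xi> * ?l" .
  have sl: "1 \<le> ?s * ?l"
    using mult_mono[OF s(1) l] s by simp
  \<comment> \<open>A common majorant: good steps contribute at most \<open>6 * Q\<close>, bad steps
    \<open>Q\<close>, and the constant 1 is at most \<open>Q\<close>.\<close>
  define Q where "Q = \<xi> ^ 4 * k1\<^sup>2 * k2 * (?s * ?l)"
  have "1 + G * W \<le> 3 * \<xi> * k1 * k2 * ?s"
  proof -
    have "1 * 1 * 1 * 1 \<le> \<xi> * k1 * k2 * ?s"
      using xi_gt_1 k s by (intro mult_mono) auto
    moreover have "G * W \<le> 2 * \<xi> * k1 * (k2 * ?s)"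
      unfolding G_def W_def k1_def[symmetric] k2_def[symmetric] mult.assoc
      using xi_gt_1 k by (intro mult_left_mono) auto
    ultimately show ?thesis
      by simp
  qed
  then have "(1 + G * W) * (2 * \<xi> * ?l) \<le> (3 * \<xi> * k1 * k2 * ?s) * (2 * \<xi> * ?l)"
    using xi_gt_1 l by (intro mult_right_mono) auto
  moreover have "(1 + G * W) * ln (A_max / A 1) \<le> (1 + G * W) * (2 * \<xi> * ?l)"
    using ln_le GW_pos by (intro mult_left_mono) linarith+
  ultimately have "(1 + G * W) * ln (A_max / A 1) \<le> (3 * \<xi> * k1 * k2 * ?s) * (2 * \<xi> * ?l)"
    by linarith
  also have "\<dots> = 6 * (\<xi>\<^sup>2 * k1 * k2 * (?s * ?l))"
    by (simp only: power2_eq_square mult_ac)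
  also have "\<dots> \<le> 6 * Q"
  proof -
    have "\<xi>\<^sup>2 \<le> \<xi> ^ 4" "k1 \<le> k1\<^sup>2"
      using xi_gt_1 k by (auto intro: power_increasing self_le_power)
    then show ?thesis
      unfolding Q_def using k sl xi_gt_1 by (intro mult_left_mono mult_right_mono mult_mono) auto
  qed
  finally have T1: "(1 + G * W) * ln (A_max / A 1) \<le> 6 * Q" .
  have "\<xi> * k1 * 1 * (V * 1) \<le> \<xi> ^ 4 * k1\<^sup>2 * k2 * (?s * ?l)"
    using xi_gt_1 k s l UV_pos by (intro mult_mono) (auto intro: self_le_power)
  then have T2: "\<xi> * V * (1 + 1 / c1) \<le> Q"
    by (simp add: Q_def k1_def mult_ac)
  have "1 * 1 * 1 * 1 \<le> \<xi> ^ 4 * k1\<^sup>2 * k2 * (?s * ?l)"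
    using xi_gt_1 k sl by (intro mult_mono) (auto intro: one_le_power)
  then have T3: "1 \<le> Q"
    by (simp add: Q_def)
  have T0: "\<exists>T. A_max \<le> A T"
  proof (rule ccontr)
    assume "\<not> ?thesis"
    then have "real n \<le> ?M" for n
      by (intro steps_bound) (simp add: not_le)
    then show False
      by (meson not_less reals_Archimedean2)
  qed
  define T where "T = (LEAST T. A_max \<le> A T)"
  have T: "A_max \<le> A T"
    unfolding T_def using T0 by (rule LeastI_ex)
  have T_pos: "0 < T"
  proof (rule ccontr)
    assume "\<not> 0 < T"
    then have "A T = 0"
      by (simp add: aine.simps(1) aine_init_def)
    with T D0_pos eps_pos show False
      by (simp add: divide_le_0_iff)
  qed
  have "real T \<le> 9 * Q"
  proof (cases "T = 1")
    case True
    with T3 show ?thesis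
      by simp
  next
    case False
    \<comment> \<open>The last index below the target is \<open>T - 1\<close>, which is
      \<open>Suc n\<close>. The two extra steps raise the total from \<open>7 * Q\<close> to
      \<open>9 * Q\<close>.\<close>
    define n where "n = T - 2"
    have n: "T = Suc (Suc n)"
      using False T_pos by (simp add: n_def)
    have "A (Suc n) < A_max"
      using not_less_Least[of "Suc n" "\<lambda>T. A_max \<le> A T"] n by (simp add: T_def[symmetric])
    from steps_bound[OF this] n T1 T2 T3 show ?thesis
      by simp
  qed
  also have "\<dots> \<le> 1000 * Q"
    using T3 by simp
  finally show thesis
    using that[OF T T_pos] by (simp add: Q_def k1_def k2_def iso_bound_def U_def V_def)
qed

end

section \<open>Subroutine iterations along the run\<close>

lemma (in aine_problem) bdgm_count_bound:
  assumes bounded: "bounded {y. f y \<le> f x0}" and R: "R = level_radius f xs x0" and eps: "0 < \<epsilon>"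
  shows "real (bdgm_count f (H (q t)) \<delta> L3 \<xi> (q t))
    \<le> bdgm_const \<xi> * log_sum [1 / \<delta>, 1 / \<epsilon>, L3, R,
        norm (grad f x0), norm (hess f x0), norm (third f x0)]"
proof -
  interpret bdgm: bdgm_problem f L3 \<delta> \<xi> "q t" "H (q t)"
    by (rule bdgm_problem)
  let ?\<Lambda> = "log_sum [1 / \<delta>, 1 / \<epsilon>, L3, R, norm (grad f x0), norm (hess f x0), norm (third f x0)]"
  let ?h = "norm (hess f x0)" and ?T = "norm (third f x0)"
  \<comment> \<open>Boundedness of the sublevel set makes the supremum in
    \<open>level_radius\<close> an actual upper bound.\<close>
  have bdd: "bdd_above ((\<lambda>y. norm (y - xs)) ` {y. f y \<le> f x0})"
  proof -
    obtain e where "\<And>y. f y \<le> f x0 \<Longrightarrow> dist xs y \<le> e"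
      using bounded unfolding bounded_any_center[of _ xs] by blast
    then show ?thesis
      by (intro bdd_aboveI2[where M = e]) (simp add: dist_norm norm_minus_commute)
  qed
  have in_R: "norm (y - xs) \<le> R" if "f y \<le> f x0" for y
    unfolding R level_radius_def using that by (intro cSUP_upper bdd) simp
  have x0: "norm (x0 - xs) \<le> R"
    by (rule in_R) simp
  have "norm (q t - xs) \<le> R"
    using invariant[of t] by (intro query_close x0 in_R) (simp add: invariant_def)
  then have d: "norm (q t - x0) \<le> 2 * R"
    using x0 norm_triangle_ineq[of "q t - xs" "xs - x0"] norm_minus_commute[of x0 xs] by simp
  have R0: "0 \<le> R"
    using x0 norm_ge_zero order_trans by blast
  have h_le: "norm (hess f (q t)) \<le> ?h + (?T + L3 * (2 * R)) * (2 * R)"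
  proof -
    have "(?T + L3 * norm (q t - x0)) * norm (q t - x0) \<le> (?T + L3 * (2 * R)) * (2 * R)"
      using d L3_pos R0 by (intro mult_mono add_left_mono mult_left_mono) auto
    then show ?thesis
      using norm_hess_bound[of "q t" x0] by linarith
  qed
  \<comment> \<open>Majorizing by a product makes the logarithm a sum. The fourth power arises
    because \<open>1 + 2 * R\<close>, which enters squared, is at most
    \<open>(2 + R)\<^sup>2\<close>.\<close>
  have "1 + norm (hess f (q t)) / \<delta> \<le> (2 + 1 / \<delta>) * (2 + ?h) * (2 + ?T) * (2 + L3) * (2 + R) ^ 4"
  proof -
    have "1 + norm (hess f (q t)) / \<delta> \<le> (1 + 1 / \<delta>) * (1 + norm (hess f (q t)))"
      using delta_pos by (simp add: distrib_left distrib_right)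
    also have "\<dots> \<le> (2 + 1 / \<delta>) * ((2 + ?h) * (2 + ?T) * (2 + L3) * (2 + R) ^ 4)"
    proof (intro mult_mono)
      have "1 + norm (hess f (q t)) \<le> (1 + ?h) + ?T * (2 * R) + L3 * (2 * R)\<^sup>2"
        using h_le by (simp add: power2_eq_square distrib_right)
      also have "\<dots> \<le> (1 + ?h) * (1 + ?T) * (1 + L3) * (1 + 2 * R)\<^sup>2"
      proof -
        have *: "(1 + a) + c * r + l * r\<^sup>2 \<le> (1 + a) * (1 + c) * (1 + l) * (1 + r)\<^sup>2"
          if "0 \<le> a" "0 \<le> c" "0 \<le> l" "0 \<le> r" for a c l r :: real
        proof -
          have "(1 + a) + c * r + l * r\<^sup>2 \<le> (1 + a) * (1 + c * r + l * r\<^sup>2)"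
            using that by (simp add: distrib_left distrib_right)
          also have "1 + c * r + l * r\<^sup>2 \<le> (1 + c) * (1 + l) * (1 + r)\<^sup>2"
            using that by (simp add: algebra_simps power2_eq_square)
          finally show ?thesis
            using that by (simp add: mult_left_mono mult.assoc)
        qed
        show ?thesis
          by (rule *) (use L3_pos R0 in auto)
      qed
      also have "\<dots> \<le> (2 + ?h) * (2 + ?T) * (2 + L3) * ((2 + R)\<^sup>2)\<^sup>2"
      proof (intro mult_mono power_mono)
        have "0 \<le> R\<^sup>2"
          by simp
        then show "1 + 2 * R \<le> (2 + R)\<^sup>2"
          using R0 unfolding power2_sum by simp
      qed (use L3_pos R0 in auto)
      finally show "1 + norm (hess f (q t)) \<le> (2 + ?h) * (2 + ?T) * (2 + L3) * (2 + R) ^ 4"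
        by (simp flip: power_mult)
    qed (use delta_pos in auto)
    finally show ?thesis
      by (simp only: mult.assoc)
  qed
  then have "ln (1 + norm (hess f (q t)) / \<delta>)
      \<le> ln ((2 + 1 / \<delta>) * (2 + ?h) * (2 + ?T) * (2 + L3) * (2 + R) ^ 4)"
    using bdgm.X_ge_1 by (intro ln_mono) linarith+
  also have "\<dots> = ln (2 + 1 / \<delta>) + ln (2 + ?h) + ln (2 + ?T) + ln (2 + L3) + 4 * ln (2 + R)"
  proof -
    have "0 < 2 + 1 / \<delta>" "0 < 2 + ?h" "0 < 2 + ?T" "0 < 2 + L3" "0 < 2 + R"
      using delta_pos L3_pos R0 by (simp_all add: add_pos_nonneg)
    then show ?thesis
      by (simp add: ln_mult_pos ln_realpow)
  qed
  finally have X_le: "ln (1 + norm (hess f (q t)) / \<delta>)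
      \<le> ln (2 + 1 / \<delta>) + ln (2 + ?h) + ln (2 + ?T) + ln (2 + L3) + 4 * ln (2 + R)" .
  \<comment> \<open>The seven logarithms thus add up to at least \<open>7 / 2\<close>, so the
    additive constant 745 is absorbed by a multiple of the sum.\<close>
  have half: "1 / 2 \<le> ln (2 + a)" if "0 \<le> a" for a :: real
  proof -
    have "ln (2::real) \<le> ln (2 + a)"
      using that by simp
    then show ?thesis
      using ln_add_one_ge[of 1] by simp
  qed
  have logs: "1 / 2 \<le> ln (2 + 1 / \<delta>)" "1 / 2 \<le> ln (2 + 1 / \<epsilon>)" "1 / 2 \<le> ln (2 + L3)"
    "1 / 2 \<le> ln (2 + R)" "1 / 2 \<le> ln (2 + norm (grad f x0))" "1 / 2 \<le> ln (2 + ?h)"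
    "1 / 2 \<le> ln (2 + ?T)"
    using delta_pos eps L3_pos R0 by (intro half; simp)+
  have Lam: "?\<Lambda> = ln (2 + 1 / \<delta>) + (ln (2 + 1 / \<epsilon>) + (ln (2 + L3) + (ln (2 + R)
      + (ln (2 + norm (grad f x0)) + (ln (2 + ?h) + ln (2 + ?T))))))"
    by (simp add: log_sum_def)
  have gen: "7 / 2 \<le> l1 + (l2 + (l3 + (l4 + (l5 + (l6 + l7)))))"
    "x \<le> 4 * (l1 + (l2 + (l3 + (l4 + (l5 + (l6 + l7))))))"
    if "x \<le> l1 + l6 + l7 + l3 + 4 * l4" "1 / 2 \<le> l1" "1 / 2 \<le> l2" "1 / 2 \<le> l3" "1 / 2 \<le> l4"
      "1 / 2 \<le> l5" "1 / 2 \<le> l6" "1 / 2 \<le> l7" for x l1 l2 l3 l4 l5 l6 l7 :: real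
    using that unfolding distrib_left by linarith+
  have L1: "7 / 2 \<le> ?\<Lambda>" and L2: "ln (1 + norm (hess f (q t)) / \<delta>) \<le> 4 * ?\<Lambda>"
    unfolding Lam by (rule gen[OF X_le logs])+
  have w: "1 \<le> \<xi> / (\<xi> - 1)"
    using xi_gt_1 by simp
  have "real (bdgm_count f (H (q t)) \<delta> L3 \<xi> (q t))
      \<le> (\<xi> / (\<xi> - 1))\<^sup>2 * (745 + 72 * ln (1 + norm (hess f (q t)) / \<delta>))"
    by (rule bdgm.bdgm_count_le)
  also have "\<dots> \<le> (\<xi> / (\<xi> - 1))\<^sup>2 * (10000 * ?\<Lambda>)"
    using L1 L2 by (intro mult_left_mono) auto
  \<comment> \<open>Weakened to match \<open>\<xi> ^ 5 / (\<xi> - 1) ^ 3\<close> in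
    \<open>bdgm_const\<close>.\<close>
  also have "\<dots> \<le> ((\<xi> / (\<xi> - 1)) ^ 3 * \<xi>\<^sup>2) * (10000 * ?\<Lambda>)"
  proof (rule mult_right_mono)
    have "(\<xi> / (\<xi> - 1))\<^sup>2 * 1 \<le> (\<xi> / (\<xi> - 1)) ^ 3 * \<xi>\<^sup>2"
      using w xi_gt_1 by (intro mult_mono power_increasing one_le_power) auto
    then show "(\<xi> / (\<xi> - 1))\<^sup>2 \<le> (\<xi> / (\<xi> - 1)) ^ 3 * \<xi>\<^sup>2"
      by simp
  qed (use L1 in simp)
  also have "\<dots> = bdgm_const \<xi> * ?\<Lambda>"
    using xi_gt_1 by (simp add: bdgm_const_def power_divide flip: power_add)
  finally show ?thesis .
qed

section \<open>Accuracy of the output and number of Hessian evaluations\<close>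

lemma (in aine_problem) eps_solution_iff: "eps_solution f \<epsilon> x \<longleftrightarrow> f x - f xs \<le> \<epsilon>"
proof -
  have "(INF y. f y) = f xs"
    using minimizer by (intro cInf_eq_minimum) auto
  then show ?thesis
    by (simp add: eps_solution_def)
qed

lemma (in aine_problem) complexity:
  assumes eps: "0 < \<epsilon>"
  shows "\<exists>T. eps_solution f \<epsilon> (st_x (S T)) \<and>
    real (st_calls (S T)) \<le> iso_const \<xi> c1 c2 * iso_bound \<delta> L3 D0 \<epsilon>"
proof (cases "D0 = 0")
  \<comment> \<open>The start is already the minimizer, so zero iterations suffice; the single
    initial call is covered by the summand 1 in \<open>iso_bound\<close>.\<close>
  case True
  then have "x0 = xs"
    by (simp add: D0_eq)
  moreover have "1 * 1 * 1 * 1 \<le> 1000 * \<xi> ^ 4 * (1 + 1 / c1)\<^sup>2 * (1 + c2)"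
    using xi_gt_1 c1_pos kappa[of 0] by (intro mult_mono one_le_power) auto
  ultimately show ?thesis
    using True eps
    by (intro exI[of _ 0]) (simp add: aine.simps(1) aine_init_def eps_solution_iff iso_const_def iso_bound_def)
next
  case False
  interpret aine_accuracy f L3 H x0 xs \<delta> \<xi> c1 c2 D0 \<kappa> \<epsilon>
    using False D0_nonneg eps by unfold_locales auto
  obtain T where T: "D0 / \<epsilon> \<le> A T" "0 < T"
    "real T \<le> 1000 * \<xi> ^ 4 * (1 + 1 / c1)\<^sup>2 * (1 + c2) * iso_bound \<delta> L3 D0 \<epsilon>"
    using iterations_bound by blast
  have "D0 / A T \<le> \<epsilon>"
    using T(1) A_pos[OF T(2)] eps by (simp add: field_simps)
  then have "eps_solution f \<epsilon> (st_x (S T))"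
    using value_bound[OF T(2)] by (simp add: eps_solution_iff)
  moreover have "st_calls (S T) = T"
    using T(2) st_calls_Suc[of "T - 1"] by simp
  ultimately show ?thesis
    using T(3) by (auto simp: iso_const_def)
qed

theorem corollary4p1:
  fixes f :: "real ^ 'd \<Rightarrow> real"
    and H :: "real ^ 'd \<Rightarrow> (real ^ 'd) \<Rightarrow>\<^sub>L (real ^ 'd)"
    and x0 xs :: "real ^ 'd"
    and \<delta> \<epsilon> L3 \<xi> c1 c2 D0 R :: real
    and \<kappa> :: "nat \<Rightarrow> real"
  assumes "convex_on UNIV f"
    and "\<And>y. f xs \<le> f y"
    and "three_times_cont_diff f"
    and "L3 > 0"
    and "\<And>x y. norm (third f x - third f y) \<le> L3 * norm (x - y)"
    and "\<delta> > 0"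
    and "hessian_estimator f \<delta> H"
    and "\<epsilon> > 0"
    and "\<xi> > 1"
    and "0 < c1" and "\<And>t. c1 \<le> \<kappa> t \<and> \<kappa> t \<le> c2"
    and "D0 = 1 / 2 * (norm (x0 - xs))\<^sup>2"
    and "R = level_radius f xs x0"
  defines "S \<equiv> aine f H \<delta> L3 \<xi> D0 \<kappa> x0"
    and "z \<equiv> \<lambda>t. aine_query \<delta> L3 D0 \<kappa> t (aine f H \<delta> L3 \<xi> D0 \<kappa> x0 t)"
  shows "(\<exists>T. eps_solution f \<epsilon> (st_x (S T)) \<and>
            real (st_calls (S T)) \<le> iso_const \<xi> c1 c2 * iso_bound \<delta> L3 D0 \<epsilon>) \<and>
         (\<forall>t. bdgm_terminates f (H (z t)) \<delta> L3 \<xi> (z t)) \<and>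
         (bounded {y. f y \<le> f x0} \<longrightarrow>
            (\<forall>t. real (bdgm_count f (H (z t)) \<delta> L3 \<xi> (z t))
               \<le> bdgm_const \<xi> * log_sum [1 / \<delta>, 1 / \<epsilon>, L3, R,
                    norm (grad f x0), norm (hess f x0), norm (third f x0)]))"
proof -
  interpret aine_problem f L3 H x0 xs \<delta> \<xi> c1 c2 D0 \<kappa>
    using assms(1-12) by unfold_locales
  show ?thesis
    unfolding S_def z_def
    using complexity bdgm_problem.bdgm_terminates[OF bdgm_problem] bdgm_count_bound assms(8,13)
    by blast
qed

end
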